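(* For all $V\in\mathbb{N}$, $$d_{\mathbb{H}(\Omega)}(\Omega_{V,1},\Omega)<\frac1V ,$$ which implies that $\lim_{V\to\infty}\Omega_{V,1}=\Omega$ in the Hausdorff metric. Let moreover, for each $V$, the probabilities be given by $\mathcal{P}^{a}=\dfrac{P_{n_1}P_{n_2}\cdots P_{n_V}}{V^{MV}}$ for every $a\in\mathcal{A}$ (where $n_1,\dots,n_V$ are the first entries of the components $a_1,\dots,a_V$ of $a$). Then $$d_{\mathbb{P}(\Omega)}(\rho_V,\rho)\le 1.4\left(\frac{M}{V}\right)^{1/4},$$ which implies $\lim_{V\to\infty}\rho_V=\rho$ in the Monge–Kantorovitch metric.
   Context: IFS. An IFS (with probabilities) on a compact metric space $Y$ is a finite family of contraction maps $g_a:Y\to Y$ together with probabilities $p_a\ge 0$, $\sum_a p_a=1$. Its set attractor is the unique non-empty compact $A\subset Y$ with $A=\bigcup_a g_a(A)$; its measure attractor is the unique Borel probability measure $\mu$ on $Y$ with $\mu=\sum_a p_a\, g_a(\mu)$, where $g(\mu)=\mu\circ g^{-1}$. Code trees. $M\geq 2$, $N,V\ge1$ are integers. $T$ is the set of all finite sequences over $\{1,\dots,M\}$, including the empty sequence $\emptyset$; $|i|$ is the length of $i\in T$ and $ij$ denotes concatenation. A code tree is a function $\tau:T\to\{1,\dots,N\}$; $\Omega$ is the set of all code trees with metric $d_\Omega(\omega,\varkappa)=M^{-k}$ for $\omega\ne\varkappa$, where $k$ is the least integer such that $\omega(i)\neq\varkappa(i)$ for some $i\in T$ with $|i|=k$;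 $\Omega$ is compact. $\Omega^V$ is the $V$-fold product with the maximum metric. $P_1,\dots,P_N>0$ are fixed with $\sum_nP_n=1$. $\rho$ is the Borel probability measure on $\Omega$ under which the random variables $\tau(i)$, $i\in T$, are i.i.d. with $\Pr(\tau(i)=n)=P_n$. The IFS $\Phi$. $\mathcal{A}=\{\{1,\dots,N\}\times\{1,\dots,V\}^M\}^V$; write $a=(a_1,\dots,a_V)\in\mathcal{A}$ with $a_v=(n_v;v_{v,1},\dots,v_{v,M})$. For $n\in\{1,\dots,N\}$ define $\xi_n:\Omega^M\to\Omega$ by $(\xi_n(\omega))(\emptyset)=n$ and $(\xi_n(\omega))(mi)=\omega_m(i)$ for $i\in T$, $m\in\{1,\dots,M\}$. For $a\in\mathcal{A}$ define $\eta^a:\Omega^V\to\Omega^V$ by letting the $v$-th component of $\eta^a(\omega_1,\dots,\omega_V)$ be $\xi_{n_v}(\omega_{v_{v,1}},\dots,\omega_{v_{v,M}})$. $\Phi=\{\Omega^V;\eta^a,\mathcal{P}^a,a\in\mathcal{A}\}$, with probabilities $\mathcal{P}^a$, is an IFS of contractions with set attractor $\Omega_V\subset\Omega^V$ and measure attractor $\mu_V$. $\Omega_{V,1}\subset\Omega$ is the set of first components of elements of $\Omega_V$, and $\rho_V(B):=\mu_V(B\times\Omega\times\cdots\times\Omega)$ for Borel $B\subset\Omega$. Metrics. $d_{\mathbb{H}(\Omega)}$ is the Hausdorff metric on non-empty compact subsets of $\Omega$. $d_{\mathbb{P}(\Omega)}$ is the Monge–Kantorovitch metric on Borel probability measures on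 $\Omega$: $d_{\mathbb{P}(\Omega)}(\mu,\nu)=\sup\{\int f\,d\mu-\int f\,d\nu\}$ over all $f:\Omega\to\mathbb{R}$ with $|f(x)-f(y)|\le d_\Omega(x,y)$ for all $x,y$. *)

theory Defs
  imports "HOL-Analysis.Analysis" "HOL-Probability.Probability"
begin

definition borel_sigma :: "'a set \<Rightarrow> ('a \<Rightarrow> 'a \<Rightarrow> real) \<Rightarrow> 'a measure" where
  "borel_sigma Y d = sigma Y {U. openin (Metric_space.mtopology Y d) U}"

definition borel_prob :: "'a set \<Rightarrow> ('a \<Rightarrow> 'a \<Rightarrow> real) \<Rightarrow> 'a measure \<Rightarrow> bool" where
  "borel_prob Y d \<mu> \<longleftrightarrow> prob_space \<mu> \<and> sets \<mu> = sets (borel_sigma Y d)"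

text \<open>Only meaningful for non-empty compact \<open>A\<close> and \<open>B\<close>; otherwise the real-valued
  suprema and infima below may be unspecified.\<close>

definition hausdorff_dist :: "('a \<Rightarrow> 'a \<Rightarrow> real) \<Rightarrow> 'a set \<Rightarrow> 'a set \<Rightarrow> real" where
  "hausdorff_dist d A B =
     max (SUP a\<in>A. INF b\<in>B. d a b) (SUP b\<in>B. INF a\<in>A. d a b)"

text \<open>The values of \<open>f\<close> outside \<open>Y\<close> do not affect the integrals, since Borel
  measures on \<open>Y\<close> have space \<open>Y\<close>.\<close>

definition monge_kantorovich ::
    "'a set \<Rightarrow> ('a \<Rightarrow> 'a \<Rightarrow> real) \<Rightarrow> 'a measure \<Rightarrow> 'a measure \<Rightarrow> real" where
  "monge_kantorovich Y d \<mu> \<nu> =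
     (SUP f\<in>{f :: 'a \<Rightarrow> real. \<forall>x\<in>Y. \<forall>y\<in>Y. \<bar>f x - f y\<bar> \<le> d x y}.
        (\<integral>x. f x \<partial>\<mu>) - (\<integral>x. f x \<partial>\<nu>))"

text \<open>An iterated function system is given by a finite index set \<open>I\<close>, maps \<open>g a\<close> and
  probabilities \<open>p a\<close> (\<open>a \<in> I\<close>). For contractions of a non-empty compact metric space
  both attractors exist and are unique, so the definite descriptions are proper.\<close>

definition set_attractor ::
    "'a set \<Rightarrow> ('a \<Rightarrow> 'a \<Rightarrow> real) \<Rightarrow> 'i set \<Rightarrow> ('i \<Rightarrow> 'a \<Rightarrow> 'a) \<Rightarrow> 'a set" where
  "set_attractor Y d I g =
     (THE A. A \<noteq> {} \<and> A \<subseteq> Y \<and> compactin (Metric_space.mtopology Y d) A \<and>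
             A = (\<Union>a\<in>I. g a ` A))"

definition measure_attractor ::
    "'a set \<Rightarrow> ('a \<Rightarrow> 'a \<Rightarrow> real) \<Rightarrow> 'i set \<Rightarrow> ('i \<Rightarrow> real) \<Rightarrow> ('i \<Rightarrow> 'a \<Rightarrow> 'a) \<Rightarrow> 'a measure" where
  "measure_attractor Y d I p g =
     (THE \<mu>. borel_prob Y d \<mu> \<and>
             (\<forall>B\<in>sets (borel_sigma Y d).
                measure \<mu> B =
                  (\<Sum>a\<in>I. p a * measure (distr \<mu> (borel_sigma Y d) (g a)) B)))"

text \<open>The first letter of a word is the head of the list. Code trees and tuples are
  extensional functions on their index sets.\<close>

definition words :: "nat \<Rightarrow> nat list set" where
  "words M = lists {1..M}"

definition code_trees :: "nat \<Rightarrow> nat \<Rightarrow> (nat list \<Rightarrow> nat) set" where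
  "code_trees M N = words M \<rightarrow>\<^sub>E {1..N}"

definition tree_dist :: "nat \<Rightarrow> (nat list \<Rightarrow> nat) \<Rightarrow> (nat list \<Rightarrow> nat) \<Rightarrow> real" where
  "tree_dist M \<omega> \<kappa> =
     (if \<omega> = \<kappa> then 0
      else 1 / real M ^ (LEAST k. \<exists>i\<in>words M. length i = k \<and> \<omega> i \<noteq> \<kappa> i))"

definition tree_tuples :: "nat \<Rightarrow> nat \<Rightarrow> nat \<Rightarrow> (nat \<Rightarrow> nat list \<Rightarrow> nat) set" where
  "tree_tuples M N V = {1..V} \<rightarrow>\<^sub>E code_trees M N"

definition tuple_dist ::
    "nat \<Rightarrow> nat \<Rightarrow> (nat \<Rightarrow> nat list \<Rightarrow> nat) \<Rightarrow> (nat \<Rightarrow> nat list \<Rightarrow> nat) \<Rightarrow> real" where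
  "tuple_dist M V x y = (MAX v\<in>{1..V}. tree_dist M (x v) (y v))"

definition iid_tree_law :: "nat \<Rightarrow> nat \<Rightarrow> (nat \<Rightarrow> real) \<Rightarrow> (nat list \<Rightarrow> nat) measure" where
  "iid_tree_law M N P =
     (THE \<mu>. borel_prob (code_trees M N) (tree_dist M) \<mu> \<and>
             prob_space.indep_vars \<mu> (\<lambda>_. count_space {1..N}) (\<lambda>i \<tau>. \<tau> i) (words M) \<and>
             (\<forall>i\<in>words M. \<forall>n\<in>{1..N}. measure \<mu> {\<tau>\<in>code_trees M N. \<tau> i = n} = P n))"

text \<open>For an index \<open>a\<close>, the label \<open>n\<^sub>v\<close> is \<open>fst (a v)\<close> and the buffer number
  \<open>v\<^sub>v\<^sub>,\<^sub>m\<close> is \<open>snd (a v) m\<close>.\<close>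

definition tree_ifs_index :: "nat \<Rightarrow> nat \<Rightarrow> nat \<Rightarrow> (nat \<Rightarrow> nat \<times> (nat \<Rightarrow> nat)) set" where
  "tree_ifs_index M N V = {1..V} \<rightarrow>\<^sub>E ({1..N} \<times> ({1..M} \<rightarrow>\<^sub>E {1..V}))"

definition graft :: "nat \<Rightarrow> nat \<Rightarrow> (nat \<Rightarrow> nat list \<Rightarrow> nat) \<Rightarrow> nat list \<Rightarrow> nat" where
  "graft M n \<omega> = (\<lambda>i\<in>words M. case i of [] \<Rightarrow> n | m # j \<Rightarrow> \<omega> m j)"

definition tree_ifs_map ::
    "nat \<Rightarrow> nat \<Rightarrow> (nat \<Rightarrow> nat \<times> (nat \<Rightarrow> nat)) \<Rightarrow>
     (nat \<Rightarrow> nat list \<Rightarrow> nat) \<Rightarrow> (nat \<Rightarrow> nat list \<Rightarrow> nat)" where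
  "tree_ifs_map M V a \<omega> =
     (\<lambda>v\<in>{1..V}. graft M (fst (a v)) (\<lambda>m\<in>{1..M}. \<omega> (snd (a v) m)))"

definition tree_ifs_prob ::
    "nat \<Rightarrow> nat \<Rightarrow> (nat \<Rightarrow> real) \<Rightarrow> (nat \<Rightarrow> nat \<times> (nat \<Rightarrow> nat)) \<Rightarrow> real" where
  "tree_ifs_prob M V P a = (\<Prod>v\<in>{1..V}. P (fst (a v))) / real V ^ (M * V)"

definition V_variable_tuples :: "nat \<Rightarrow> nat \<Rightarrow> nat \<Rightarrow> (nat \<Rightarrow> nat list \<Rightarrow> nat) set" where
  "V_variable_tuples M N V =
     set_attractor (tree_tuples M N V) (tuple_dist M V) (tree_ifs_index M N V) (tree_ifs_map M V)"

definition V_variable_trees :: "nat \<Rightarrow> nat \<Rightarrow> nat \<Rightarrow> (nat list \<Rightarrow> nat) set" where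
  "V_variable_trees M N V = (\<lambda>x. x 1) ` V_variable_tuples M N V"

definition V_variable_tuple_law ::
    "nat \<Rightarrow> nat \<Rightarrow> nat \<Rightarrow> (nat \<Rightarrow> real) \<Rightarrow> (nat \<Rightarrow> nat list \<Rightarrow> nat) measure" where
  "V_variable_tuple_law M N V P =
     measure_attractor (tree_tuples M N V) (tuple_dist M V) (tree_ifs_index M N V)
       (tree_ifs_prob M V P) (tree_ifs_map M V)"

definition V_variable_tree_law ::
    "nat \<Rightarrow> nat \<Rightarrow> nat \<Rightarrow> (nat \<Rightarrow> real) \<Rightarrow> (nat list \<Rightarrow> nat) measure" where
  "V_variable_tree_law M N V P =
     distr (V_variable_tuple_law M N V P) (borel_sigma (code_trees M N) (tree_dist M)) (\<lambda>x. x 1)"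

end

theory Submission
  imports Defs "HOL-Real_Asymp.Real_Asymp"
begin

text \<open>Let the buffers \<open>1, \<dots>, V\<close> be followed from the root downwards. As long as the nodes of each
  level of a tree sit in pairwise distinct buffers, their labels can be prescribed independently. If
  \<open>M ^ k \<le> V < M ^ (k + 1)\<close>, there is room for this down to level \<open>k\<close>, so every tree agrees with an element
  of \<open>\<Omega>\<^sub>V\<^sub>,\<^sub>1\<close> on levels \<open>0, \<dots>, k\<close>; this is the Hausdorff bound.

  When the buffers are chosen at random, the probability of a collision on levels \<open>1, \<dots>, k\<close> is at
  most \<open>\<epsilon> = (M\<^sup>2 + \<dots> + M ^ (2 * k)) / (2 * V)\<close>. Hence \<open>\<rho>\<^sub>V\<close> gives each cylinder of depth \<open>k\<close> at least
  \<open>1 - \<epsilon>\<close> times its \<open>\<rho>\<close>-mass, and the Monge--Kantorovich distance is at most \<open>1 / M ^ (k + 1) + \<epsilon>\<close>.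
  The choice \<open>M ^ (4 * k) \<le> V < M ^ (4 * (k + 1))\<close> gives the rate \<open>V powr (- 1 / 4)\<close>. All estimates for the
  measure attractor use only its invariance equation, by induction on the depth.\<close>

text \<open>One index acts on all buffers at once, so trees in different buffers are dependent, and
  the subtrees of a tree cannot be treated one at a time. The induction therefore follows a whole
  level: it asserts agreement with the given tree below all nodes of level l simultaneously, for
  every assignment of distinct buffers to them, and one use of invariance moves the assignment to
  level l + 1.

  A lower bound on cylinder masses suffices because both laws have total mass 1: a relative deficit
  of at most e means that mass at most e is moved across a space of diameter at most 1, while inside
  a cylinder the cost is its diameter.

  The root occupies one buffer, so depth k + 1 costs collisions only on levels 1 to k, and a
  geometric sum bounds these by (2/3) M^(2k) / V. With y = V^(1/4) this is at most (2/3) / y^2, of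
  lower order than the resolution 1 / y. As y >= 2 once k >= 1, the total is at most (4/3) / y, and
  4/3 < 1.4.

  The attractors and the i.i.d. law are definite descriptions, so existence and uniqueness have to
  be proved before anything can be said about them.\<close>

section \<open>Metrics given by agreement up to a level\<close>

text \<open>\<open>r k x\<close> names the closed ball of radius \<open>1 / b ^ k\<close> that contains \<open>x\<close>; for code trees it is the
  restriction of \<open>x\<close> to the first \<open>k\<close> levels.\<close>

locale level_metric =
  fixes Y :: "'a set" and d :: "'a \<Rightarrow> 'a \<Rightarrow> real" and b :: nat and r :: "nat \<Rightarrow> 'a \<Rightarrow> 'c"
  assumes b_ge_2: "b \<ge> 2"
    and dist_nonneg: "\<And>x y. 0 \<le> d x y"
    and dist_commute: "\<And>x y. d x y = d y x"
    and dist_le_iff: "\<And>x y k. x \<in> Y \<Longrightarrow> y \<in> Y \<Longrightarrow> d x y \<le> 1 / real b ^ k \<longleftrightarrow> r k x = r k y"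
    and dist_values: "\<And>x y. x \<in> Y \<Longrightarrow> y \<in> Y \<Longrightarrow> x \<noteq> y \<Longrightarrow> \<exists>k. d x y = 1 / real b ^ k"
    and dist_self: "\<And>x. x \<in> Y \<Longrightarrow> d x x = 0"
    and restr_0: "\<And>x y. x \<in> Y \<Longrightarrow> y \<in> Y \<Longrightarrow> r 0 x = r 0 y"
    and finite_restr: "\<And>k. finite (r k ` Y)"
    and Y_nonempty: "Y \<noteq> {}"
begin

lemma inverse_power_mono: "j \<le> k \<Longrightarrow> 1 / real b ^ k \<le> 1 / real b ^ j"
  using b_ge_2 by (intro divide_left_mono power_increasing) auto

lemma inverse_power_tendsto_0: "(\<lambda>k. 1 / real b ^ k) \<longlonglongrightarrow> 0"
proof -
  have "(\<lambda>k. (1 / real b) ^ k) \<longlonglongrightarrow> 0"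
    using b_ge_2 by (intro LIMSEQ_power_zero) auto
  then show ?thesis by (simp add: power_one_over)
qed

lemma inverse_power_less: "e > 0 \<Longrightarrow> \<exists>k. 1 / real b ^ k < e"
  using order_tendstoD(2)[OF inverse_power_tendsto_0, of e] eventually_happens'[of sequentially]
  by auto

lemma restr_mono:
  assumes "x \<in> Y" "y \<in> Y" "r k x = r k y" "j \<le> k"
  shows "r j x = r j y"
proof -
  have "d x y \<le> 1 / real b ^ k" using assms dist_le_iff by simp
  also have "\<dots> \<le> 1 / real b ^ j" using \<open>j \<le> k\<close> by (rule inverse_power_mono)
  finally show ?thesis using assms dist_le_iff by simp
qed

sublocale Metric_space Y d
proof
  show "0 \<le> d x y" "d x y = d y x" for x y
    by (rule dist_nonneg dist_commute)+
  show zero: "d x y = 0 \<longleftrightarrow> x = y" if "x \<in> Y" "y \<in> Y" for x y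
  proof
    assume 0: "d x y = 0"
    show "x = y"
    proof (rule ccontr)
      assume "x \<noteq> y"
      then obtain k where "d x y = 1 / real b ^ k" using dist_values \<open>x \<in> Y\<close> \<open>y \<in> Y\<close> by blast
      then show False using 0 b_ge_2 by simp
    qed
  qed (use dist_self that in simp)
  fix x y z assume Y: "x \<in> Y" "y \<in> Y" "z \<in> Y"
  show "d x z \<le> d x y + d y z"
  proof (cases "x = y \<or> y = z")
    case True
    then show ?thesis using Y dist_nonneg by (auto simp: dist_self)
  next
    case False
    obtain i where i: "d x y = 1 / real b ^ i" using dist_values Y False by blast
    obtain j where j: "d y z = 1 / real b ^ j" using dist_values Y False by blast
    note ij = i j
    \<comment> \<open>Agreement up to the smaller of the two levels is transitive, so the metric is
      in fact an ultrametric.\<close>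
    have "r (min i j) x = r (min i j) z"
    proof -
      have "d x y \<le> 1 / real b ^ min i j" "d y z \<le> 1 / real b ^ min i j"
        unfolding ij by (intro inverse_power_mono; simp)+
      then show ?thesis using dist_le_iff Y by simp
    qed
    then have "d x z \<le> 1 / real b ^ min i j" using dist_le_iff Y by blast
    also have "\<dots> \<le> d x y + d y z"
      using dist_nonneg[of x y] dist_nonneg[of y z] ij by (simp add: min_def)
    finally show ?thesis .
  qed
qed

section \<open>Cylinders: topology, Borel sets and measures\<close>

definition cylinder :: "nat \<Rightarrow> 'c \<Rightarrow> 'a set" where
  "cylinder k c = {x \<in> Y. r k x = c}"

lemma cylinder_subset: "cylinder k c \<subseteq> Y"
  by (auto simp: cylinder_def)

lemma cylinder_0: "x \<in> Y \<Longrightarrow> cylinder 0 (r 0 x) = Y"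
  unfolding cylinder_def using restr_0[of _ x] by blast

text \<open>The cylinder of depth \<open>k\<close> around a point is the closed ball of radius 1 /
  b^k and contains the open one, so cylinders form a base of the topology.\<close>

lemma openin_iff_cylinder:
  "openin mtopology U \<longleftrightarrow> U \<subseteq> Y \<and> (\<forall>x\<in>U. \<exists>k. cylinder k (r k x) \<subseteq> U)"
  (is "?L \<longleftrightarrow> ?R")
proof
  assume L: ?L
  then have sub: "U \<subseteq> Y" by (simp add: openin_mtopology)
  have "\<exists>k. cylinder k (r k x) \<subseteq> U" if x: "x \<in> U" for x
  proof -
    obtain e where e: "e > 0" "mball x e \<subseteq> U" using L x by (auto simp: openin_mtopology)
    obtain k where k: "1 / real b ^ k < e" using inverse_power_less e(1) by blast
    have "cylinder k (r k x) \<subseteq> mball x e"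
    proof
      fix y assume "y \<in> cylinder k (r k x)"
      then have "y \<in> Y" "d x y \<le> 1 / real b ^ k"
        using sub x dist_le_iff by (auto simp: cylinder_def)
      then show "y \<in> mball x e" using sub x k by auto
    qed
    with e show ?thesis by blast
  qed
  with sub show ?R by blast
next
  assume R: ?R
  have "\<exists>e>0. mball x e \<subseteq> U" if x: "x \<in> U" for x
  proof -
    obtain k where k: "cylinder k (r k x) \<subseteq> U" using R x by blast
    have "mball x (1 / real b ^ k) \<subseteq> cylinder k (r k x)"
    proof
      fix y assume "y \<in> mball x (1 / real b ^ k)"
      then show "y \<in> cylinder k (r k x)" using dist_le_iff[of x y k] by (simp add: cylinder_def)
    qed
    with k show ?thesis using b_ge_2 by (intro exI[of _ "1 / real b ^ k"]) auto
  qed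
  with R show ?L by (auto simp: openin_mtopology)
qed

text \<open>Two cylinders are nested or disjoint; with the empty set added, the family is closed
  under intersection, as the uniqueness theorem for measures demands.\<close>

definition cylinders :: "'a set set" where
  "cylinders = insert {} {cylinder k c | k c. c \<in> r k ` Y}"

lemma openin_cylinder: "openin mtopology (cylinder k c)"
  unfolding openin_iff_cylinder using cylinder_subset by (auto simp: cylinder_def)

text \<open>Each depth has only finitely many cylinders, so an open set is the countable union, over
  all depths, of the cylinders that it contains.\<close>

lemma sets_borel_sigma: "sets (borel_sigma Y d) = sigma_sets Y cylinders"
proof -
  let ?O = "{U. openin mtopology U}"
  have O: "?O \<subseteq> Pow Y" using openin_subset by fastforce
  interpret S: sigma_algebra Y "sigma_sets Y cylinders"
    by (rule sigma_algebra_sigma_sets) (auto simp: cylinders_def cylinder_def)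
  have "U \<in> sigma_sets Y cylinders" if "openin mtopology U" for U
  proof -
    let ?C = "\<lambda>k. {c \<in> r k ` Y. cylinder k c \<subseteq> U}"
    have "(\<Union>c\<in>?C k. cylinder k c) \<in> sigma_sets Y cylinders" for k
    proof (rule S.finite_UN)
      show "finite (?C k)" using finite_restr by simp
      show "cylinder k c \<in> sigma_sets Y cylinders" if "c \<in> ?C k" for c
        using that by (intro sigma_sets.Basic) (auto simp: cylinders_def)
    qed
    then have "(\<Union>k. \<Union>c\<in>?C k. cylinder k c) \<in> sigma_sets Y cylinders"
      by (intro S.countable_nat_UN) blast
    moreover have "U = (\<Union>k. \<Union>c\<in>?C k. cylinder k c)"
    proof (intro subset_antisym subsetI)
      fix x assume x: "x \<in> U"
      then obtain k where "x \<in> Y" "cylinder k (r k x) \<subseteq> U"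
        using \<open>openin mtopology U\<close> unfolding openin_iff_cylinder by blast
      then show "x \<in> (\<Union>k. \<Union>c\<in>?C k. cylinder k c)" by (auto simp: cylinder_def)
    qed blast
    ultimately show ?thesis by simp
  qed
  then have "sigma_sets Y ?O \<subseteq> sigma_sets Y cylinders"
    by (intro S.sigma_sets_subset) auto
  moreover have "sigma_sets Y cylinders \<subseteq> sigma_sets Y ?O"
    by (intro sigma_sets_mono') (auto simp: cylinders_def openin_cylinder)
  ultimately show ?thesis using O by (simp add: borel_sigma_def)
qed

lemma space_borel_sigma [simp]: "space (borel_sigma Y d) = Y"
  by (simp add: borel_sigma_def space_measure_of_conv)

lemma cylinder_in_sets: "cylinder k c \<in> sets (borel_sigma Y d)"
proof -
  have "{U. openin mtopology U} \<subseteq> Pow Y" using openin_subset by fastforce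
  then show ?thesis by (simp add: borel_sigma_def openin_cylinder)
qed

lemma restr_Collect_in_sets: "{x \<in> Y. Q (r k x)} \<in> sets (borel_sigma Y d)"
proof -
  have "{x \<in> Y. Q (r k x)} = (\<Union>c\<in>{c \<in> r k ` Y. Q c}. cylinder k c)"
    by (auto simp: cylinder_def)
  also have "\<dots> \<in> sets (borel_sigma Y d)"
    using finite_restr by (intro sets.finite_UN) (auto intro: cylinder_in_sets)
  finally show ?thesis .
qed

lemma Int_stable_cylinders: "Int_stable cylinders"
proof (rule Int_stableI)
  have *: "cylinder j a \<inter> cylinder k c \<in> cylinders"
    if "j \<le> k" "a \<in> r j ` Y" "c \<in> r k ` Y" for j k a c
  proof -
    obtain y where y: "y \<in> Y" "c = r k y" using \<open>c \<in> _\<close> by blast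
    have "cylinder j a \<inter> cylinder k c = (if r j y = a then cylinder k c else {})"
    proof -
      have "r j x = r j y" if "x \<in> Y" "r k x = r k y" for x
        using that y \<open>j \<le> k\<close> by (intro restr_mono[of x y k j])
      then show ?thesis unfolding cylinder_def y(2) by auto
    qed
    then show ?thesis using that by (auto simp: cylinders_def)
  qed
  fix A B assume "A \<in> cylinders" "B \<in> cylinders"
  then consider "A = {} \<or> B = {}"
    | j a k c where "A = cylinder j a" "B = cylinder k c" "a \<in> r j ` Y" "c \<in> r k ` Y"
    by (auto simp: cylinders_def)
  then show "A \<inter> B \<in> cylinders"
  proof cases
    case 1 then show ?thesis by (auto simp: cylinders_def)
  next
    case 2 then show ?thesis using *[of j k a c] *[of k j c a] by (metis Int_commute nat_le_linear)
  qed
qed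

lemma measurable_borel_sigmaI:
  assumes f: "f \<in> space N \<rightarrow> Y"
    and C: "\<And>k c. c \<in> r k ` Y \<Longrightarrow> {x \<in> space N. r k (f x) = c} \<in> sets N"
  shows "f \<in> measurable N (borel_sigma Y d)"
proof (rule measurable_sigma_sets[OF sets_borel_sigma _ f])
  show "cylinders \<subseteq> Pow Y" by (auto simp: cylinders_def cylinder_def)
  fix A assume "A \<in> cylinders"
  then consider "A = {}" | k c where "A = cylinder k c" "c \<in> r k ` Y" by (auto simp: cylinders_def)
  then show "f -` A \<inter> space N \<in> sets N"
  proof cases
    case 1 then show ?thesis by simp
  next
    case 2
    have "f -` A \<inter> space N = {x \<in> space N. r k (f x) = c}" using f 2 by (auto simp: cylinder_def)
    then show ?thesis using C[OF 2(2)] by simp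
  qed
qed

lemma borel_prob_space: "borel_prob Y d \<mu> \<Longrightarrow> space \<mu> = Y"
  unfolding borel_prob_def using sets_eq_imp_space_eq space_borel_sigma by blast

lemma borel_prob_eqI:
  assumes \<mu>: "borel_prob Y d \<mu>" and \<nu>: "borel_prob Y d \<nu>"
    and eq: "\<And>k c. c \<in> r k ` Y \<Longrightarrow> measure \<mu> (cylinder k c) = measure \<nu> (cylinder k c)"
  shows "\<mu> = \<nu>"
proof -
  interpret \<mu>: prob_space \<mu> using \<mu> by (simp add: borel_prob_def)
  interpret \<nu>: prob_space \<nu> using \<nu> by (simp add: borel_prob_def)
  obtain y where y: "y \<in> Y" using Y_nonempty by blast
  show ?thesis
  proof (rule measure_eqI_generator_eq[where A="\<lambda>_. Y", OF Int_stable_cylinders])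
    show "cylinders \<subseteq> Pow Y" by (auto simp: cylinders_def cylinder_def)
    show "emeasure \<mu> X = emeasure \<nu> X" if "X \<in> cylinders" for X
      using that eq by (auto simp: cylinders_def \<mu>.emeasure_eq_measure \<nu>.emeasure_eq_measure)
    show "sets \<mu> = sigma_sets Y cylinders" "sets \<nu> = sigma_sets Y cylinders"
      using \<mu> \<nu> by (simp_all add: borel_prob_def sets_borel_sigma)
    have "cylinder 0 (r 0 y) \<in> cylinders" using y by (auto simp: cylinders_def)
    then show "range (\<lambda>_. Y) \<subseteq> cylinders" using cylinder_0[OF y] by simp
  qed auto
qed

text \<open>A compact set is closed here, so a point outside it has a whole cylinder outside it.
  This turns agreement at every depth into membership.\<close>

lemma compact_imp_restr_closed:
  assumes A: "compactin mtopology A" and x: "x \<in> Y" and lim: "\<And>k. \<exists>y\<in>A. r k y = r k x"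
  shows "x \<in> A"
proof (rule ccontr)
  assume "x \<notin> A"
  have "closedin mtopology A"
    using A Hausdorff_space_mtopology compactin_imp_closedin by blast
  then have "openin mtopology (Y - A)" and AY: "A \<subseteq> Y" by (auto simp: closedin_def)
  then obtain k where k: "cylinder k (r k x) \<subseteq> Y - A"
    using x \<open>x \<notin> A\<close> unfolding openin_iff_cylinder by blast
  then show False using lim[of k] AY by (auto simp: cylinder_def)
qed

subsection \<open>The Monge--Kantorovich distance\<close>

text \<open>\<open>f\<close> is a limit of functions that depend on \<open>r k x\<close> only: on
  each cylinder replace \<open>f\<close> by its value at a chosen point, with error at most 1 /
  b^k.\<close>

lemma lipschitz_measurable:
  assumes "\<forall>x\<in>Y. \<forall>y\<in>Y. \<bar>f x - f y\<bar> \<le> d x y"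
  shows "f \<in> borel_measurable (borel_sigma Y d)"
proof -
  define pick where "pick k c = (SOME y. y \<in> Y \<and> r k y = c)" for k c
  have pick: "pick k (r k x) \<in> Y \<and> r k (pick k (r k x)) = r k x" if "x \<in> Y" for k x
    unfolding pick_def using that by (intro someI[where P="\<lambda>y. y \<in> Y \<and> r k y = r k x"]) auto
  show ?thesis
  proof (rule borel_measurable_LIMSEQ_real[where u="\<lambda>k x. f (pick k (r k x))"])
    fix x assume "x \<in> space (borel_sigma Y d)"
    then have x: "x \<in> Y" by simp
    have bound: "\<bar>f (pick k (r k x)) - f x\<bar> \<le> 1 / real b ^ k" for k
      using assms pick[OF x, of k] x dist_le_iff[of "pick k (r k x)" x k] by (meson order_trans)
    have "(\<lambda>k. f (pick k (r k x)) - f x) \<longlonglongrightarrow> 0"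
      by (rule Lim_null_comparison[OF _ inverse_power_tendsto_0]) (use bound in auto)
    then show "(\<lambda>k. f (pick k (r k x))) \<longlonglongrightarrow> f x" by (simp add: LIM_zero_iff)
  next
    show "(\<lambda>x. f (pick k (r k x))) \<in> borel_measurable (borel_sigma Y d)" for k
      using restr_Collect_in_sets[where Q="\<lambda>c. f (pick k c) \<in> A" for A]
      by (intro measurableI) (auto simp: vimage_def Int_def conj_commute)
  qed
qed

lemma integral_restr:
  assumes \<mu>: "borel_prob Y d \<mu>"
  shows "(\<integral>x. F (r k x) \<partial>\<mu>) = (\<Sum>c\<in>r k ` Y. F c * measure \<mu> (cylinder k c))"
    and "integrable \<mu> (\<lambda>x. F (r k x))"
proof -
  interpret prob_space \<mu> using \<mu> by (simp add: borel_prob_def)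
  have meas: "cylinder k c \<in> sets \<mu>" for c
    using \<mu> cylinder_in_sets by (simp add: borel_prob_def)
  have eq: "F (r k x) = (\<Sum>c\<in>r k ` Y. F c * indicat_real (cylinder k c) x)" if "x \<in> space \<mu>" for x
  proof -
    have x: "x \<in> Y" using that borel_prob_space[OF \<mu>] by simp
    have "(\<Sum>c\<in>r k ` Y. F c * indicat_real (cylinder k c) x)
        = (\<Sum>c\<in>r k ` Y. if c = r k x then F c else 0)"
      using x by (intro sum.cong) (auto simp: cylinder_def)
    then show ?thesis using finite_restr x by simp
  qed
  have int: "integrable \<mu> (\<lambda>x. \<Sum>c\<in>r k ` Y. F c * indicat_real (cylinder k c) x)"
    using meas by (intro Bochner_Integration.integrable_sum integrable_mult_right integrable_real_indicator)
      (auto simp: emeasure_eq_measure)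
  show "integrable \<mu> (\<lambda>x. F (r k x))"
    using int by (subst Bochner_Integration.integrable_cong[OF refl eq]) auto
  have "(\<integral>x. F (r k x) \<partial>\<mu>) = (\<integral>x. (\<Sum>c\<in>r k ` Y. F c * indicat_real (cylinder k c) x) \<partial>\<mu>)"
    by (rule Bochner_Integration.integral_cong[OF refl eq])
  also have "\<dots> = (\<Sum>c\<in>r k ` Y. F c * measure \<mu> (cylinder k c))"
    using meas by (subst Bochner_Integration.integral_sum) (auto simp: emeasure_eq_measure)
  finally show "(\<integral>x. F (r k x) \<partial>\<mu>) = (\<Sum>c\<in>r k ` Y. F c * measure \<mu> (cylinder k c))" .
qed

lemma sum_cylinder_measure:
  assumes "borel_prob Y d \<mu>"
  shows "(\<Sum>c\<in>r k ` Y. measure \<mu> (cylinder k c)) = 1"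
proof -
  interpret prob_space \<mu> using assms by (simp add: borel_prob_def)
  show ?thesis using integral_restr(1)[OF assms, of "\<lambda>_. 1" k] by (simp add: prob_space)
qed

lemma dist_le_1: "x \<in> Y \<Longrightarrow> y \<in> Y \<Longrightarrow> d x y \<le> 1"
  using dist_le_iff[of x y 0] restr_0[of x y] by simp

text \<open>The supremum \<open>F\<close> of \<open>f\<close> over cylinders dominates
  \<open>f\<close>, which settles the integral against \<open>\<mu>\<close>; against
  \<open>\<nu>\<close> the replacement costs 1 / b^k. What remains is a comparison of two finite
  distributions, where the mass bound enters.\<close>

lemma lipschitz_integral_diff_le:
  assumes \<mu>: "borel_prob Y d \<mu>" and \<nu>: "borel_prob Y d \<nu>"
    and lip: "\<forall>x\<in>Y. \<forall>y\<in>Y. \<bar>f x - f y\<bar> \<le> d x y"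
    and mass: "\<And>c. c \<in> r k ` Y \<Longrightarrow> (1 - e) * measure \<nu> (cylinder k c) \<le> measure \<mu> (cylinder k c)"
    and e: "e \<ge> 0"
  shows "(\<integral>x. f x \<partial>\<mu>) - (\<integral>x. f x \<partial>\<nu>) \<le> 1 / real b ^ k + e"
proof -
  interpret \<mu>: prob_space \<mu> using \<mu> by (simp add: borel_prob_def)
  interpret \<nu>: prob_space \<nu> using \<nu> by (simp add: borel_prob_def)
  define F where "F c = (SUP x\<in>cylinder k c. f x)" for c
  obtain y0 where y0: "y0 \<in> Y" using Y_nonempty by blast
  have bnd: "\<bar>f x - f y\<bar> \<le> 1" if "x \<in> Y" "y \<in> Y" for x y
    using lip that dist_le_1 by (meson order_trans)
  have bdd: "bdd_above (f ` S)" if "S \<subseteq> Y" for S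
  proof (rule bdd_aboveI2)
    show "f x \<le> f y0 + 1" if "x \<in> S" for x
      using bnd[of x y0] y0 that \<open>S \<subseteq> Y\<close> by (auto simp: abs_le_iff)
  qed
  have le_F: "f x \<le> F (r k x)" if "x \<in> Y" for x
    unfolding F_def using that by (intro cSUP_upper bdd cylinder_subset) (auto simp: cylinder_def)
  have F_le: "F (r k x) \<le> f x + 1 / real b ^ k" if x: "x \<in> Y" for x
    unfolding F_def
  proof (rule cSUP_least)
    show "cylinder k (r k x) \<noteq> {}" using x by (auto simp: cylinder_def)
    fix z assume "z \<in> cylinder k (r k x)"
    then have "z \<in> Y" "d z x \<le> 1 / real b ^ k" using x dist_le_iff by (auto simp: cylinder_def)
    moreover have "\<bar>f z - f x\<bar> \<le> d z x" using lip x \<open>z \<in> Y\<close> by blast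
    ultimately show "f z \<le> f x + 1 / real b ^ k" by linarith
  qed
  define S where "S = (SUP x\<in>Y. f x)"
  have F_le_S: "F c \<le> S" if "c \<in> r k ` Y" for c
    unfolding F_def S_def using that
    by (intro cSUP_subset_mono bdd cylinder_subset) (auto simp: cylinder_def)
  have S_le: "S \<le> F c + 1" if c: "c \<in> r k ` Y" for c
    unfolding S_def
  proof (rule cSUP_least[OF Y_nonempty])
    obtain y where "y \<in> Y" "c = r k y" using c by blast
    then show "f x \<le> F c + 1" if "x \<in> Y" for x
      using le_F[of y] bnd[OF that, of y] by (simp add: abs_le_iff)
  qed
  have fint: "integrable \<rho> f" if \<rho>: "borel_prob Y d \<rho>" for \<rho>
  proof -
    interpret \<rho>: prob_space \<rho> using \<rho> by (simp add: borel_prob_def)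
    have "sets \<rho> = sets (borel_sigma Y d)" using \<rho> by (simp add: borel_prob_def)
    then have "f \<in> borel_measurable \<rho>"
      using lipschitz_measurable[OF lip] measurable_cong_sets by blast
    then show ?thesis
    proof (intro \<rho>.integrable_const_bound[where B="\<bar>f y0\<bar> + 1"] AE_I2)
      fix x assume "x \<in> space \<rho>"
      then have "\<bar>f x - f y0\<bar> \<le> 1" using bnd y0 borel_prob_space[OF \<rho>] by simp
      then show "norm (f x) \<le> \<bar>f y0\<bar> + 1" by simp
    qed
  qed
  let ?h = "\<lambda>x. F (r k x)"
  let ?q = "\<lambda>\<rho> c. measure \<rho> (cylinder k c)"
  have "(\<integral>x. f x \<partial>\<mu>) \<le> (\<integral>x. ?h x \<partial>\<mu>)"
    using le_F borel_prob_space[OF \<mu>] by (intro integral_mono fint \<mu> integral_restr) auto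
  moreover have "(\<integral>x. ?h x \<partial>\<nu>) \<le> (\<integral>x. f x + 1 / real b ^ k \<partial>\<nu>)"
    using F_le borel_prob_space[OF \<nu>]
    by (intro integral_mono integral_restr \<nu> Bochner_Integration.integrable_add fint) auto
  moreover have "(\<integral>x. f x + 1 / real b ^ k \<partial>\<nu>) = (\<integral>x. f x \<partial>\<nu>) + 1 / real b ^ k"
    using fint[OF \<nu>] by (simp add: \<nu>.prob_space)
  moreover have "(\<integral>x. ?h x \<partial>\<mu>) - (\<integral>x. ?h x \<partial>\<nu>) \<le> e"
  proof -
    \<comment> \<open>Both distributions have total mass 1, so \<open>F\<close> may be shifted by
      the constant \<open>S\<close>. The weights \<open>S - F c\<close> then lie in [0, 1], and an
      upper bound for the differences \<open>?q \<nu> c - ?q \<mu> c\<close> is enough.\<close>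
    have "(\<Sum>c\<in>r k ` Y. (S - F c) * (?q \<nu> c - ?q \<mu> c)) \<le> (\<Sum>c\<in>r k ` Y. 1 * (e * ?q \<nu> c))"
    proof (rule sum_mono)
      fix c assume c: "c \<in> r k ` Y"
      have "(S - F c) * (?q \<nu> c - ?q \<mu> c) \<le> (S - F c) * (e * ?q \<nu> c)"
        using mass[OF c] F_le_S[OF c] by (intro mult_left_mono) (auto simp: algebra_simps)
      also have "\<dots> \<le> 1 * (e * ?q \<nu> c)"
        using S_le[OF c] e by (intro mult_right_mono) auto
      finally show "(S - F c) * (?q \<nu> c - ?q \<mu> c) \<le> 1 * (e * ?q \<nu> c)" .
    qed
    also have "\<dots> = e" using sum_cylinder_measure[OF \<nu>, of k] by (simp flip: sum_distrib_left)
    finally have "(\<Sum>c\<in>r k ` Y. (S - F c) * (?q \<nu> c - ?q \<mu> c)) \<le> e" .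
    moreover have "(\<Sum>c\<in>r k ` Y. (S - F c) * (?q \<nu> c - ?q \<mu> c))
        = S * (\<Sum>c\<in>r k ` Y. ?q \<nu> c) - S * (\<Sum>c\<in>r k ` Y. ?q \<mu> c)
          - (\<Sum>c\<in>r k ` Y. F c * ?q \<nu> c) + (\<Sum>c\<in>r k ` Y. F c * ?q \<mu> c)"
      by (simp add: sum_distrib_left sum.distrib sum_subtractf algebra_simps)
    ultimately show ?thesis
      by (simp add: integral_restr(1) \<mu> \<nu> sum_cylinder_measure)
  qed
  ultimately show ?thesis by linarith
qed

lemma monge_kantorovich_bounds:
  assumes "borel_prob Y d \<mu>" "borel_prob Y d \<nu>"
    and "\<And>c. c \<in> r k ` Y \<Longrightarrow> (1 - e) * measure \<nu> (cylinder k c) \<le> measure \<mu> (cylinder k c)"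
    and "e \<ge> 0"
  shows "monge_kantorovich Y d \<mu> \<nu> \<le> 1 / real b ^ k + e"
    and "0 \<le> monge_kantorovich Y d \<mu> \<nu>"
proof -
  let ?L = "{f :: 'a \<Rightarrow> real. \<forall>x\<in>Y. \<forall>y\<in>Y. \<bar>f x - f y\<bar> \<le> d x y}"
  have zero: "(\<lambda>_. 0) \<in> ?L" by simp
  have bound: "(\<integral>x. f x \<partial>\<mu>) - (\<integral>x. f x \<partial>\<nu>) \<le> 1 / real b ^ k + e" if "f \<in> ?L" for f
    using that lipschitz_integral_diff_le[OF assms(1,2) _ assms(3,4)] by simp
  show "monge_kantorovich Y d \<mu> \<nu> \<le> 1 / real b ^ k + e"
    unfolding monge_kantorovich_def
  proof (rule cSUP_least)
    show "?L \<noteq> {}"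
    proof
      assume "?L = {}"
      with zero show False by (simp only: empty_iff)
    qed
  qed (rule bound)
  \<comment> \<open>A real supremum bounds its members only if the family is bounded above;
    \<open>bound\<close> supplies this, and the zero function then gives nonnegativity.\<close>
  have "bdd_above ((\<lambda>f. (\<integral>x. f x \<partial>\<mu>) - (\<integral>x. f x \<partial>\<nu>)) ` ?L)"
    using bound by (rule bdd_aboveI2)
  from cSUP_upper[OF zero this] show "0 \<le> monge_kantorovich Y d \<mu> \<nu>"
    unfolding monge_kantorovich_def by simp
qed

subsection \<open>The Hausdorff distance to the whole space\<close>

text \<open>As \<open>A\<close> lies in \<open>Y\<close>, the supremum over \<open>A\<close>
  vanishes, and only the density of \<open>A\<close> at depth \<open>k\<close> counts.\<close>

lemma hausdorff_dist_bounds: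
  assumes A: "A \<subseteq> Y" "A \<noteq> {}" and dense: "\<And>y. y \<in> Y \<Longrightarrow> \<exists>x\<in>A. r k x = r k y"
  shows "hausdorff_dist d A Y \<le> 1 / real b ^ k" and "0 \<le> hausdorff_dist d A Y"
proof -
  have bdd: "bdd_below (g ` S)" if "\<And>x. (0::real) \<le> g x" for g :: "'a \<Rightarrow> real" and S
    using that by (intro bdd_belowI2)
  have 1: "(INF y\<in>Y. d x y) = 0" if "x \<in> A" for x
  proof (rule antisym)
    have x: "x \<in> Y" using that A by blast
    show "(INF y\<in>Y. d x y) \<le> 0"
      using cINF_lower[OF bdd[of "d x"] x] by (simp add: dist_self x)
    show "0 \<le> (INF y\<in>Y. d x y)" using Y_nonempty by (intro cINF_greatest) auto
  qed
  have 2: "(INF x\<in>A. d x y) \<le> 1 / real b ^ k" if "y \<in> Y" for y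
  proof -
    obtain x where x: "x \<in> A" "r k x = r k y" using dense[OF \<open>y \<in> Y\<close>] by blast
    have "(INF x\<in>A. d x y) \<le> d x y" using x by (intro cINF_lower bdd) auto
    also have "\<dots> \<le> 1 / real b ^ k" using x A that dist_le_iff by blast
    finally show ?thesis .
  qed
  have eq: "(SUP x\<in>A. INF y\<in>Y. d x y) = 0" using A 1 by (simp cong: SUP_cong)
  show "0 \<le> hausdorff_dist d A Y" unfolding hausdorff_dist_def eq by simp
  show "hausdorff_dist d A Y \<le> 1 / real b ^ k"
    unfolding hausdorff_dist_def eq using 2 Y_nonempty by (auto intro!: cSUP_least)
qed

end

section \<open>Iterated function systems for such metrics\<close>

text \<open>\<open>code\<close> is the coding map that sends \<open>a\<^sub>0 a\<^sub>1 a\<^sub>2 \<dots>\<close> to the limit of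
  \<open>g a\<^sub>0 \<circ> g a\<^sub>1 \<circ> g a\<^sub>2 \<circ> \<dots>\<close>. The set attractor is its range, and the measure attractor is
  the image of the law of an i.i.d. sequence of indices.\<close>

locale level_ifs = level_metric Y d b r
  for Y :: "'a set" and d b and r :: "nat \<Rightarrow> 'a \<Rightarrow> 'c" +
  fixes I :: "'i set" and g :: "'i \<Rightarrow> 'a \<Rightarrow> 'a" and code :: "'i stream \<Rightarrow> 'a"
    and p :: "'i \<Rightarrow> real"
  assumes finite_I: "finite I"
    and I_nonempty: "I \<noteq> {}"
    and g_in: "\<And>a x. a \<in> I \<Longrightarrow> x \<in> Y \<Longrightarrow> g a x \<in> Y"
    and g_contracts: "\<And>a x y k. a \<in> I \<Longrightarrow> x \<in> Y \<Longrightarrow> y \<in> Y \<Longrightarrow> r k x = r k y \<Longrightarrow>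
      r (Suc k) (g a x) = r (Suc k) (g a y)"
    and code_in: "\<And>s. s \<in> streams I \<Longrightarrow> code s \<in> Y"
    and code_SCons: "\<And>a s. a \<in> I \<Longrightarrow> s \<in> streams I \<Longrightarrow> code (a ## s) = g a (code s)"
    and p_nonneg: "\<And>a. a \<in> I \<Longrightarrow> 0 \<le> p a"
    and p_sum: "(\<Sum>a\<in>I. p a) = 1"
begin

subsection \<open>The set attractor\<close>

text \<open>Each leading index in common gains one level through \<open>g_contracts\<close>. This is
  the continuity of the coding map.\<close>

lemma restr_code_stake:
  assumes "s \<in> streams I" "t \<in> streams I" "stake k s = stake k t"
  shows "r k (code s) = r k (code t)"
  using assms
proof (induction k arbitrary: s t)
  case 0
  then show ?case by (intro restr_0 code_in)
next
  case (Suc k)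
  obtain a s' where s: "s = a ## s'" by (metis stream.collapse)
  obtain b t' where t: "t = b ## t'" by (metis stream.collapse)
  have ab: "a \<in> I" "b = a" "s' \<in> streams I" "t' \<in> streams I" "stake k s' = stake k t'"
    using Suc.prems by (simp_all add: s t streams_Stream)
  then have "r (Suc k) (g a (code s')) = r (Suc k) (g a (code t'))"
    by (intro g_contracts Suc.IH code_in)
  then show ?case unfolding s t using ab by (simp add: code_SCons)
qed

lemma code_invariant: "code ` streams I = (\<Union>a\<in>I. g a ` code ` streams I)"
proof (intro subset_antisym subsetI)
  fix x assume "x \<in> code ` streams I"
  then obtain s where s: "s \<in> streams I" "x = code s" by blast
  then have "shd s \<in> I" "stl s \<in> streams I" by (simp_all add: streams_shd streams_stl)
  moreover from this have "x = g (shd s) (code (stl s))"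
    using code_SCons[of "shd s" "stl s"] s by simp
  ultimately show "x \<in> (\<Union>a\<in>I. g a ` code ` streams I)" by blast
next
  fix x assume "x \<in> (\<Union>a\<in>I. g a ` code ` streams I)"
  then obtain a s where "a \<in> I" "s \<in> streams I" "x = g a (code s)" by blast
  then have "x = code (a ## s)" "a ## s \<in> streams I" by (simp_all add: code_SCons streams_Stream)
  then show "x \<in> code ` streams I" by blast
qed

text \<open>The range is a continuous image of a product of countably many copies of the finite
  discrete space \<open>I\<close>, which is compact by Tychonoff's theorem.\<close>

lemma compactin_code: "compactin mtopology (code ` streams I)"
proof -
  let ?T = "product_topology (\<lambda>_::nat. discrete_topology I) UNIV"
  have top: "topspace ?T = UNIV \<rightarrow>\<^sub>E I" by simp
  have in_streams: "to_stream f \<in> streams I" if "f \<in> topspace ?T" for f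
    using that by (auto simp: to_stream_in_streams)
  have "continuous_map ?T mtopology (code \<circ> to_stream)"
    unfolding continuous_map
  proof (intro conjI allI impI subsetI)
    show "x \<in> topspace mtopology" if "x \<in> (code \<circ> to_stream) ` topspace ?T" for x
      using that in_streams by (auto intro: code_in)
    fix U assume U: "openin mtopology U"
    show "openin ?T {f \<in> topspace ?T. (code \<circ> to_stream) f \<in> U}"
      (is "openin ?T ?S")
    proof (subst openin_subopen, intro ballI)
      fix f assume f: "f \<in> ?S"
      then obtain k where k: "cylinder k (r k (code (to_stream f))) \<subseteq> U"
        using U unfolding openin_iff_cylinder by auto
      \<comment> \<open>Freezing the first \<open>k\<close> coordinates gives an open neighbourhood
        on which the code is constant up to depth \<open>k\<close>.\<close>
      let ?B = "\<Pi>\<^sub>E n\<in>UNIV. if n < k then {f n} else I"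
      have "openin ?T ?B"
        using f by (intro openin_PiE_gen[THEN iffD2] disjI2)
          (auto intro: finite_subset[of _ "{..<k}"] split: if_splits)
      moreover have "f \<in> ?B" using f by auto
      moreover have "?B \<subseteq> ?S"
      proof
        fix h assume h: "h \<in> ?B"
        then have hT: "h \<in> topspace ?T" using f by (auto simp: PiE_iff split: if_splits) metis
        have "stake k (to_stream h) = stake k (to_stream f)"
          using h by (intro nth_equalityI) (auto simp: to_stream_def PiE_iff split: if_splits)
        then have "r k (code (to_stream h)) = r k (code (to_stream f))"
          using hT f by (intro restr_code_stake in_streams) auto
        then have "code (to_stream h) \<in> cylinder k (r k (code (to_stream f)))"
          using in_streams[OF hT] by (simp add: cylinder_def code_in)
        with k hT show "h \<in> ?S" by auto
      qed
      ultimately show "\<exists>T. openin ?T T \<and> f \<in> T \<and> T \<subseteq> ?S" by blast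
    qed
  qed
  moreover have "compactin ?T (topspace ?T)"
    using finite_I unfolding compact_space_def[symmetric]
    by (simp add: compact_space_product_topology compact_space_discrete_topology)
  ultimately have "compactin mtopology ((code \<circ> to_stream) ` topspace ?T)"
    by (intro image_compactin)
  moreover have "(code \<circ> to_stream) ` topspace ?T = code ` streams I"
  proof -
    have "to_stream ` (UNIV \<rightarrow>\<^sub>E I) = streams I"
    proof (intro subset_antisym subsetI)
      fix s assume s: "s \<in> streams I"
      then have "snth s \<in> UNIV \<rightarrow>\<^sub>E I" by (auto simp: streams_iff_snth)
      moreover have "s = to_stream (snth s)"
        by (simp add: to_stream_def stream_smap_nats)
      ultimately show "s \<in> to_stream ` (UNIV \<rightarrow>\<^sub>E I)" by blast
    next
      fix s assume "s \<in> to_stream ` (UNIV \<rightarrow>\<^sub>E I)"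
      then show "s \<in> streams I" by (auto simp: to_stream_in_streams PiE_iff)
    qed
    then show ?thesis by (simp only: top image_comp[symmetric])
  qed
  ultimately show ?thesis by simp
qed

text \<open>Write \<open>x\<close> as the image of a point under \<open>k\<close> maps, replace that
  point by one of \<open>A\<close>, and apply the same maps: the result lies in \<open>A\<close> and
  agrees with \<open>x\<close> to depth \<open>k\<close>. Used in both directions, this makes the
  attractor unique.\<close>

lemma invariant_dense:
  assumes A: "A = (\<Union>a\<in>I. g a ` A)" "A \<subseteq> Y" "A \<noteq> {}"
    and B: "B = (\<Union>a\<in>I. g a ` B)" "B \<subseteq> Y" and x: "x \<in> B"
  shows "\<exists>y\<in>A. r k y = r k x"
  using x
proof (induction k arbitrary: x)
  case 0
  then show ?case using A B restr_0 by blast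
next
  case (Suc k)
  then obtain a z where a: "a \<in> I" "z \<in> B" "x = g a z" using B(1) by blast
  then obtain y where y: "y \<in> A" "r k y = r k z" using Suc.IH by blast
  then have "g a y \<in> A" using a A(1) by blast
  moreover have "r (Suc k) (g a y) = r (Suc k) x"
    unfolding \<open>x = _\<close> using a y A(2) B(2) by (intro g_contracts) auto
  ultimately show ?case by blast
qed

lemma set_attractor_eq: "set_attractor Y d I g = code ` streams I"
  unfolding set_attractor_def
proof (rule the_equality)
  have ne: "code ` streams I \<noteq> {}"
    using I_nonempty by (auto simp: streams_empty_iff)
  have sub: "code ` streams I \<subseteq> Y" using code_in by blast
  show A: "code ` streams I \<noteq> {} \<and> code ` streams I \<subseteq> Y \<and> compactin mtopology (code ` streams I) \<and>
      code ` streams I = (\<Union>a\<in>I. g a ` code ` streams I)"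
    using ne sub compactin_code code_invariant by blast
  fix A assume A: "A \<noteq> {} \<and> A \<subseteq> Y \<and> compactin mtopology A \<and> A = (\<Union>a\<in>I. g a ` A)"
  show "A = code ` streams I"
  proof (intro subset_antisym subsetI)
    show "x \<in> code ` streams I" if x: "x \<in> A" for x
    proof (rule compact_imp_restr_closed[OF compactin_code])
      show "x \<in> Y" using A x by blast
      show "\<exists>y\<in>code ` streams I. r k y = r k x" for k
        by (rule invariant_dense[where B=A]) (use code_invariant ne sub A x in blast)+
    qed
    show "x \<in> A" if x: "x \<in> code ` streams I" for x
    proof (rule compact_imp_restr_closed)
      show "compactin mtopology A" using A by blast
      show "x \<in> Y" using sub x by blast
      show "\<exists>y\<in>A. r k y = r k x" for k
        by (rule invariant_dense[where B="code ` streams I"]) (use code_invariant ne sub A x in blast)+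
    qed
  qed
qed

lemma set_attractor_invariant:
  "set_attractor Y d I g = (\<Union>a\<in>I. g a ` set_attractor Y d I g)"
  "set_attractor Y d I g \<noteq> {}" "set_attractor Y d I g \<subseteq> Y"
  unfolding set_attractor_eq using code_invariant I_nonempty code_in
  by (blast, simp add: streams_empty_iff, blast)

subsection \<open>The measure attractor\<close>

text \<open>Contraction read backwards: an event about \<open>g a x\<close> of depth at most k + 1
  is an event about \<open>x\<close> of depth \<open>k\<close>. Measurability of the maps and
  uniqueness of the invariant measure rest on it.\<close>

lemma restr_g_factors:
  assumes a: "a \<in> I" and j: "j \<le> Suc k"
  obtains R' where "\<And>x. x \<in> Y \<Longrightarrow> R (r j (g a x)) \<longleftrightarrow> R' (r k x)"
proof
  fix x assume x: "x \<in> Y"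
  have "r j (g a y) = r j (g a x)" if "y \<in> Y" "r k y = r k x" for y
    using a x that j by (intro restr_mono[of _ _ "Suc k" j] g_in g_contracts)
  then show "R (r j (g a x)) \<longleftrightarrow> (\<exists>y\<in>Y. r k y = r k x \<and> R (r j (g a y)))"
    using x by metis
qed

lemma measurable_g:
  assumes a: "a \<in> I"
  shows "g a \<in> measurable (borel_sigma Y d) (borel_sigma Y d)"
proof (rule measurable_borel_sigmaI)
  show "g a \<in> space (borel_sigma Y d) \<rightarrow> Y" using g_in[OF a] by simp
  fix k c
  obtain R where R: "\<And>x. x \<in> Y \<Longrightarrow> r k (g a x) = c \<longleftrightarrow> R (r k x)"
    by (rule restr_g_factors[OF a, where k=k and j=k and R="\<lambda>c'. c' = c"]) auto
  have "{x \<in> space (borel_sigma Y d). r k (g a x) = c} = {x \<in> Y. R (r k x)}"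
    unfolding space_borel_sigma by (intro Collect_cong conj_cong refl R)
  also have "\<dots> \<in> sets (borel_sigma Y d)" by (rule restr_Collect_in_sets)
  finally show "{x \<in> space (borel_sigma Y d). r k (g a x) = c} \<in> sets (borel_sigma Y d)" .
qed

definition invariant_measure :: "'a measure \<Rightarrow> bool" where
  "invariant_measure \<mu> \<longleftrightarrow> borel_prob Y d \<mu> \<and>
     (\<forall>B\<in>sets (borel_sigma Y d). measure \<mu> B = (\<Sum>a\<in>I. p a * measure \<mu> {x \<in> Y. g a x \<in> B}))"

text \<open>For measurable maps the image measures become preimages. The equivalence holds for every
  \<open>\<mu>\<close>, so it can rewrite the definite description.\<close>

lemma measure_attractor_cond_iff:
  "borel_prob Y d \<mu> \<and> (\<forall>B\<in>sets (borel_sigma Y d).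
     measure \<mu> B = (\<Sum>a\<in>I. p a * measure (distr \<mu> (borel_sigma Y d) (g a)) B))
   \<longleftrightarrow> invariant_measure \<mu>"
proof -
  have "measure (distr \<mu> (borel_sigma Y d) (g a)) B = measure \<mu> {x \<in> Y. g a x \<in> B}"
    if \<mu>: "borel_prob Y d \<mu>" and "a \<in> I" "B \<in> sets (borel_sigma Y d)" for a B
  proof -
    have "sets \<mu> = sets (borel_sigma Y d)" using \<mu> by (simp add: borel_prob_def)
    then have "g a \<in> measurable \<mu> (borel_sigma Y d)"
      using measurable_g[OF \<open>a \<in> I\<close>] measurable_cong_sets by blast
    then show ?thesis
      using that borel_prob_space[OF \<mu>]
      by (subst measure_distr) (auto intro!: arg_cong[where f="measure \<mu>"])
  qed
  then show ?thesis unfolding invariant_measure_def by (simp cong: sum.cong conj_cong)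
qed

text \<open>The invariance equation expresses the mass of an event of depth k + 1 through masses of
  events of depth k, and at depth 0 the only events are \<open>Y\<close> and the empty set.\<close>

lemma invariant_measure_unique:
  assumes \<mu>: "invariant_measure \<mu>" and \<nu>: "invariant_measure \<nu>"
  shows "\<mu> = \<nu>"
proof (rule borel_prob_eqI)
  show \<mu>': "borel_prob Y d \<mu>" and \<nu>': "borel_prob Y d \<nu>"
    using \<mu> \<nu> by (simp_all add: invariant_measure_def)
  have sp: "measure \<mu> Y = 1" "measure \<nu> Y = 1"
    using \<mu>' \<nu>' borel_prob_space[OF \<mu>'] borel_prob_space[OF \<nu>'] prob_space.prob_space
    unfolding borel_prob_def by metis+
  have "measure \<mu> {x \<in> Y. Q (r k x)} = measure \<nu> {x \<in> Y. Q (r k x)}" for Q k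
  proof (induction k arbitrary: Q)
    case 0
    obtain y where y: "y \<in> Y" using Y_nonempty by blast
    have "{x \<in> Y. Q (r 0 x)} = {x \<in> Y. Q (r 0 y)}"
      by (intro Collect_cong conj_cong refl arg_cong[where f=Q] restr_0 y)
    then have "{x \<in> Y. Q (r 0 x)} = (if Q (r 0 y) then Y else {})" by simp
    then show ?case using sp by simp
  next
    case (Suc k)
    let ?B = "{x \<in> Y. Q (r (Suc k) x)}"
    have B: "?B \<in> sets (borel_sigma Y d)" by (rule restr_Collect_in_sets)
    have "measure \<mu> {x \<in> Y. g a x \<in> ?B} = measure \<nu> {x \<in> Y. g a x \<in> ?B}" if a: "a \<in> I" for a
    proof -
      obtain R where R: "\<And>x. x \<in> Y \<Longrightarrow> Q (r (Suc k) (g a x)) \<longleftrightarrow> R (r k x)"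
        by (rule restr_g_factors[OF a, where k=k and j="Suc k" and R=Q]) auto
      have "{x \<in> Y. g a x \<in> ?B} = {x \<in> Y. Q (r (Suc k) (g a x))}" using g_in[OF a] by blast
      also have "\<dots> = {x \<in> Y. R (r k x)}" by (intro Collect_cong conj_cong refl R)
      finally show ?thesis using Suc.IH[of R] by simp
    qed
    then have "(\<Sum>a\<in>I. p a * measure \<mu> {x \<in> Y. g a x \<in> ?B})
        = (\<Sum>a\<in>I. p a * measure \<nu> {x \<in> Y. g a x \<in> ?B})"
      by (intro sum.cong refl) (simp only:)
    moreover have "measure \<rho> ?B = (\<Sum>a\<in>I. p a * measure \<rho> {x \<in> Y. g a x \<in> ?B})"
      if "invariant_measure \<rho>" for \<rho>
      using that B unfolding invariant_measure_def by blast
    note this[OF \<mu>] this[OF \<nu>]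
    ultimately show ?case by (simp only:)
  qed
  from this[of "\<lambda>c'. c' = c" for c]
  show "measure \<mu> (cylinder k c) = measure \<nu> (cylinder k c)" for k c by (simp add: cylinder_def)
qed

lemma ex_invariant_measure: "\<exists>\<mu>. invariant_measure \<mu>"
proof -
  define Q where "Q = point_measure I p"
  have space_Q: "space Q = I" and sets_Q: "sets Q = Pow I"
    by (simp_all add: Q_def space_point_measure sets_point_measure)
  interpret Q: prob_space Q
    unfolding Q_def
  proof (rule prob_space_point_measure)
    have "(\<Sum>a\<in>I. ennreal (p a)) = ennreal (\<Sum>a\<in>I. p a)" by (rule sum_ennreal) (rule p_nonneg)
    then show "(\<Sum>a\<in>I. ennreal (p a)) = 1" by (simp only: p_sum ennreal_1)
  qed (use finite_I in simp_all)
  let ?S = "stream_space Q"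
  interpret S: prob_space ?S by (rule Q.prob_space_stream_space)
  have space_S: "space ?S = streams I" by (simp add: space_stream_space space_Q)
  \<comment> \<open>Shown for all conditions \<open>R\<close> at once, because splitting off the
    first index changes the condition.\<close>
  have code_sets: "{s \<in> streams I. R (r k (code s))} \<in> sets ?S" for R k
  proof (induction k arbitrary: R)
    case 0
    obtain y where y: "y \<in> Y" using Y_nonempty by blast
    have "{s \<in> streams I. R (r 0 (code s))} = {s \<in> streams I. R (r 0 y)}"
      by (intro Collect_cong conj_cong refl arg_cong[where f=R] restr_0 code_in y)
    then have "{s \<in> streams I. R (r 0 (code s))} = (if R (r 0 y) then space ?S else {})"
      by (simp add: space_S)
    then show ?case by simp
  next
    case (Suc k)
    have "\<exists>R'. \<forall>x\<in>Y. R (r (Suc k) (g a x)) \<longleftrightarrow> R' (r k x)" if "a \<in> I" for a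
      by (rule restr_g_factors[OF that, where k=k and j="Suc k" and R=R]) auto
    then obtain R' where R': "\<And>a x. a \<in> I \<Longrightarrow> x \<in> Y \<Longrightarrow> R (r (Suc k) (g a x)) \<longleftrightarrow> R' a (r k x)"
      by metis
    have iff: "R (r (Suc k) (code s)) \<longleftrightarrow> R' (shd s) (r k (code (stl s)))" if s: "s \<in> streams I" for s
    proof -
      have in_I: "shd s \<in> I" "stl s \<in> streams I" using s by (simp_all add: streams_shd streams_stl)
      have "code s = g (shd s) (code (stl s))" using code_SCons[OF in_I] by simp
      then show ?thesis using R'[OF in_I(1) code_in[OF in_I(2)]] by simp
    qed
    have "{s \<in> streams I. R (r (Suc k) (code s))} =
        (\<Union>a\<in>I. (shd -` {a} \<inter> space ?S) \<inter>
          (stl -` {t \<in> streams I. R' a (r k (code t))} \<inter> space ?S))"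
      using iff by (auto simp: space_S streams_shd streams_stl)
    also have "\<dots> \<in> sets ?S"
      using Suc.IH finite_I
      by (intro sets.finite_UN sets.Int measurable_sets[OF measurable_shd] measurable_sets[OF measurable_stl])
        (auto simp: sets_Q)
    finally show ?case .
  qed
  have code_meas: "code \<in> measurable ?S (borel_sigma Y d)"
    by (rule measurable_borel_sigmaI) (use code_in code_sets in \<open>auto simp: space_S\<close>)
  define \<mu> where "\<mu> = distr ?S (borel_sigma Y d) code"
  have \<mu>: "borel_prob Y d \<mu>"
    unfolding \<mu>_def borel_prob_def using S.prob_space_distr[OF code_meas] by simp
  interpret \<mu>: prob_space \<mu> using \<mu> by (simp add: borel_prob_def)
  have "measure \<mu> B = (\<Sum>a\<in>I. p a * measure \<mu> {x \<in> Y. g a x \<in> B})"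
    if B: "B \<in> sets (borel_sigma Y d)" for B
  proof -
    have pre: "{x \<in> Y. g a x \<in> B} \<in> sets (borel_sigma Y d)" if "a \<in> I" for a
      using measurable_sets[OF measurable_g[OF that] B] by (simp add: vimage_def Int_def conj_commute)
    have "emeasure \<mu> B = emeasure ?S (code -` B \<inter> space ?S)"
      unfolding \<mu>_def by (rule emeasure_distr[OF code_meas B])
    \<comment> \<open>Removing the first index leaves a stream with the same law; with
      \<open>code_SCons\<close> this becomes the invariance equation.\<close>
    also have "\<dots> = (\<integral>\<^sup>+a. emeasure ?S {s \<in> space ?S. a ## s \<in> code -` B \<inter> space ?S} \<partial>Q)"
      by (rule Q.emeasure_stream_space[OF measurable_sets[OF code_meas B]])
    also have "\<dots> = (\<Sum>a\<in>I. ennreal (p a) *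
        emeasure ?S {s \<in> space ?S. a ## s \<in> code -` B \<inter> space ?S})"
      unfolding Q_def using finite_I p_nonneg
      by (subst nn_integral_point_measure_finite) (auto simp: mult.commute)
    also have "\<dots> = (\<Sum>a\<in>I. ennreal (p a) * emeasure \<mu> {x \<in> Y. g a x \<in> B})"
    proof (intro sum.cong refl arg_cong2[where f=times])
      fix a assume a: "a \<in> I"
      have "{s \<in> space ?S. a ## s \<in> code -` B \<inter> space ?S} = code -` {x \<in> Y. g a x \<in> B} \<inter> space ?S"
        using a by (auto simp: space_S code_SCons code_in streams_Stream)
      then show "emeasure ?S {s \<in> space ?S. a ## s \<in> code -` B \<inter> space ?S} = emeasure \<mu> {x \<in> Y. g a x \<in> B}"
        unfolding \<mu>_def by (simp add: emeasure_distr[OF code_meas pre[OF a]])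
    qed
    also have "\<dots> = ennreal (\<Sum>a\<in>I. p a * measure \<mu> {x \<in> Y. g a x \<in> B})"
      using p_nonneg by (subst sum_ennreal[symmetric]) (auto simp: \<mu>.emeasure_eq_measure ennreal_mult)
    finally show ?thesis
      using p_nonneg by (simp add: \<mu>.emeasure_eq_measure sum_nonneg)
  qed
  with \<mu> show ?thesis unfolding invariant_measure_def by blast
qed

lemma invariant_measure_attractor: "invariant_measure (measure_attractor Y d I p g)"
  unfolding measure_attractor_def measure_attractor_cond_iff
  using ex_invariant_measure invariant_measure_unique by (metis theI')

end

section \<open>Code trees and tuples of code trees\<close>

definition level :: "nat \<Rightarrow> nat \<Rightarrow> nat list set" where
  "level M l = {i \<in> words M. length i = l}"

text \<open>The starting level \<open>l\<close> is a parameter because the estimates peel off the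
  top level and pass from \<open>l\<close> to l + 1; see \<open>levels_Suc\<close>.\<close>

definition levels :: "nat \<Rightarrow> nat \<Rightarrow> nat \<Rightarrow> nat list set" where
  "levels M l k = {i \<in> words M. l \<le> length i \<and> length i < l + k}"

text \<open>Depth \<open>k\<close> keeps the levels 0 to k - 1, since trees at distance 1 / M^k
  first differ on level \<open>k\<close>.\<close>

definition tree_restr :: "nat \<Rightarrow> nat \<Rightarrow> (nat list \<Rightarrow> nat) \<Rightarrow> nat list \<Rightarrow> nat" where
  "tree_restr M k \<tau> = restrict \<tau> (levels M 0 k)"

definition tuple_restr ::
    "nat \<Rightarrow> nat \<Rightarrow> nat \<Rightarrow> (nat \<Rightarrow> nat list \<Rightarrow> nat) \<Rightarrow> nat \<Rightarrow> nat list \<Rightarrow> nat" where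
  "tuple_restr M V k x = (\<lambda>v\<in>{1..V}. tree_restr M k (x v))"

lemma Nil_in_words [simp]: "[] \<in> words M"
  and Cons_in_words [simp]: "m # i \<in> words M \<longleftrightarrow> m \<in> {1..M} \<and> i \<in> words M"
  and append_in_words [simp]: "i @ j \<in> words M \<longleftrightarrow> i \<in> words M \<and> j \<in> words M"
  by (auto simp: words_def)

lemma finite_level [simp]: "finite (level M l)" and card_level [simp]: "card (level M l) = M ^ l"
proof -
  have eq: "level M l = {xs. set xs \<subseteq> {1..M} \<and> length xs = l}"
    by (auto simp: level_def words_def lists_eq_set)
  show "finite (level M l)" unfolding eq by (intro finite_lists_length_eq) simp
  show "card (level M l) = M ^ l" unfolding eq by (simp add: card_lists_length_eq)
qed

lemma level_0 [simp]: "level M 0 = {[]}"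
  by (auto simp: level_def)

lemma levels_0 [simp]: "levels M l 0 = {}"
  by (auto simp: levels_def)

lemma levels_Suc: "levels M l (Suc k) = level M l \<union> levels M (Suc l) k"
  by (auto simp: levels_def level_def)

lemma level_disjoint_levels: "level M l \<inter> levels M (Suc l) k = {}"
  by (auto simp: levels_def level_def)

lemma finite_levels [simp]: "finite (levels M l k)"
  by (induction k arbitrary: l) (simp_all add: levels_Suc)

lemma levels_subset_words: "levels M l k \<subseteq> words M"
  by (auto simp: levels_def)

lemma mem_levels_iff: "i \<in> levels M 0 k \<longleftrightarrow> i \<in> words M \<and> length i < k"
  by (auto simp: levels_def)

lemma tree_restr_eq_iff:
  "tree_restr M k \<omega> = tree_restr M k \<kappa> \<longleftrightarrow> (\<forall>i\<in>levels M 0 k. \<omega> i = \<kappa> i)"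
  unfolding tree_restr_def restrict_def fun_eq_iff by auto

lemma tuple_restr_eq_iff:
  "tuple_restr M V k x = tuple_restr M V k y \<longleftrightarrow>
     (\<forall>v\<in>{1..V}. tree_restr M k (x v) = tree_restr M k (y v))"
  unfolding tuple_restr_def restrict_def fun_eq_iff[where 'a=nat and 'b="nat list \<Rightarrow> nat"] by (auto split: if_splits)

section \<open>Code trees and their tuples as instances of the metric setting\<close>

lemma level_metric_trees:
  assumes M: "M \<ge> 2" and N: "N \<ge> 1"
  shows "level_metric (code_trees M N) (tree_dist M) M (tree_restr M)"
proof
  show "2 \<le> M" by fact
  show "0 \<le> tree_dist M \<omega> \<kappa>" for \<omega> \<kappa> by (simp add: tree_dist_def)
  show "tree_dist M \<omega> \<kappa> = tree_dist M \<kappa> \<omega>" for \<omega> \<kappa>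
  proof -
    have "(\<lambda>k. \<exists>i\<in>words M. length i = k \<and> \<omega> i \<noteq> \<kappa> i) = (\<lambda>k. \<exists>i\<in>words M. length i = k \<and> \<kappa> i \<noteq> \<omega> i)"
      by (intro ext bex_cong conj_cong refl neq_commute)
    then show ?thesis by (cases "\<omega> = \<kappa>") (simp_all add: tree_dist_def)
  qed
  show "tree_dist M \<omega> \<omega> = 0" for \<omega> by (simp add: tree_dist_def)
  show "\<exists>k. tree_dist M \<omega> \<kappa> = 1 / real M ^ k" if "\<omega> \<noteq> \<kappa>" for \<omega> \<kappa>
    using that by (auto simp: tree_dist_def)
  show "tree_restr M 0 \<omega> = tree_restr M 0 \<kappa>" for \<omega> \<kappa> by (simp add: tree_restr_eq_iff)
  show "finite (tree_restr M k ` code_trees M N)" for k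
  proof (rule finite_subset)
    show "tree_restr M k ` code_trees M N \<subseteq> levels M 0 k \<rightarrow>\<^sub>E {1..N}"
      using levels_subset_words[of M 0 k]
      by (auto simp: tree_restr_def code_trees_def PiE_iff)
  qed (intro finite_PiE; simp)
  have "(\<lambda>i\<in>words M. 1) \<in> code_trees M N" using N by (auto simp: code_trees_def)
  then show "code_trees M N \<noteq> {}" by blast
  fix \<omega> \<kappa> k assume trees: "\<omega> \<in> code_trees M N" "\<kappa> \<in> code_trees M N"
  show "tree_dist M \<omega> \<kappa> \<le> 1 / real M ^ k \<longleftrightarrow> tree_restr M k \<omega> = tree_restr M k \<kappa>"
  proof (cases "\<omega> = \<kappa>")
    case True
    then show ?thesis by (simp add: tree_dist_def)
  next
    case False
    let ?D = "\<lambda>l. \<exists>i\<in>words M. length i = l \<and> \<omega> i \<noteq> \<kappa> i"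
    obtain i where "i \<in> words M" "\<omega> i \<noteq> \<kappa> i"
      using False PiE_ext[OF trees[unfolded code_trees_def]] by blast
    then have ex: "?D (length i)" by blast
    have "tree_dist M \<omega> \<kappa> \<le> 1 / real M ^ k \<longleftrightarrow> real M ^ k \<le> real M ^ (LEAST l. ?D l)"
      using False M by (simp add: tree_dist_def field_simps)
    also have "\<dots> \<longleftrightarrow> k \<le> (LEAST l. ?D l)" using M by simp
    also have "\<dots> \<longleftrightarrow> (\<forall>l<k. \<not> ?D l)"
      using LeastI[of ?D, OF ex] not_less_Least[of _ ?D] by (meson le_less_trans not_le order_less_le_trans)
    also have "\<dots> \<longleftrightarrow> tree_restr M k \<omega> = tree_restr M k \<kappa>"
      unfolding tree_restr_eq_iff by (auto simp: mem_levels_iff)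
    finally show ?thesis .
  qed
qed

lemma tuple_dist_le_iff:
  assumes "V \<ge> 1"
  shows "tuple_dist M V x y \<le> c \<longleftrightarrow> (\<forall>v\<in>{1..V}. tree_dist M (x v) (y v) \<le> c)"
  using assms by (simp add: tuple_dist_def)

lemma tuple_dist_in:
  assumes "V \<ge> 1"
  shows "\<exists>v\<in>{1..V}. tuple_dist M V x y = tree_dist M (x v) (y v)"
proof -
  have "tuple_dist M V x y \<in> (\<lambda>v. tree_dist M (x v) (y v)) ` {1..V}"
    unfolding tuple_dist_def using assms by (intro Max_in) auto
  then show ?thesis by blast
qed

lemma level_metric_tuples:
  assumes M: "M \<ge> 2" and N: "N \<ge> 1" and V: "V \<ge> 1"
  shows "level_metric (tree_tuples M N V) (tuple_dist M V) M (tuple_restr M V)"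
proof -
  interpret T: level_metric "code_trees M N" "tree_dist M" M "tree_restr M"
    by (rule level_metric_trees[OF M N])
  have comp: "x v \<in> code_trees M N" if "x \<in> tree_tuples M N V" "v \<in> {1..V}" for x v
    using that by (auto simp: tree_tuples_def)
  show ?thesis
  proof
    show "2 \<le> M" by fact
    show "0 \<le> tuple_dist M V x y" for x y using tuple_dist_in[OF V, of M x y] T.dist_nonneg by auto
    show "tuple_dist M V x y = tuple_dist M V y x" for x y
      unfolding tuple_dist_def by (simp only: T.dist_commute[of "x _"])
    fix x y assume xy: "x \<in> tree_tuples M N V" "y \<in> tree_tuples M N V"
    show "tuple_dist M V x y \<le> 1 / real M ^ k \<longleftrightarrow> tuple_restr M V k x = tuple_restr M V k y" for k
      using xy comp by (simp add: tuple_dist_le_iff[OF V] tuple_restr_eq_iff T.dist_le_iff)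
    show "tuple_restr M V 0 x = tuple_restr M V 0 y"
      by (simp add: tuple_restr_eq_iff tree_restr_eq_iff)
    show "\<exists>k. tuple_dist M V x y = 1 / real M ^ k" if "x \<noteq> y"
    proof -
      obtain u where u: "u \<in> {1..V}" "x u \<noteq> y u"
        using \<open>x \<noteq> y\<close> PiE_ext[OF xy[unfolded tree_tuples_def]] by blast
      \<comment> \<open>The maximum may be attained at a component other than \<open>u\<close>. It
        is positive because of \<open>u\<close>, so the two trees at \<open>v\<close> differ and
        their distance is a power.\<close>
      obtain v where v: "v \<in> {1..V}" "tuple_dist M V x y = tree_dist M (x v) (y v)"
        using tuple_dist_in[OF V] by blast
      have "0 < tree_dist M (x u) (y u)"
        using u comp xy by (simp add: T.mdist_pos_eq)
      also have "\<dots> \<le> tuple_dist M V x y" using u(1) tuple_dist_le_iff[OF V] by blast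
      finally have "x v \<noteq> y v" using v(2) by (auto simp: tree_dist_def)
      then show ?thesis
        unfolding v(2) using comp[OF xy(1) v(1)] comp[OF xy(2) v(1)] by (rule T.dist_values[rotated 2])
    qed
  next
    show "tuple_dist M V x x = 0" for x
      using tuple_dist_in[OF V, of M x x] by (auto simp: tree_dist_def)
    show "finite (tuple_restr M V k ` tree_tuples M N V)" for k
    proof (rule finite_subset)
      show "tuple_restr M V k ` tree_tuples M N V \<subseteq> {1..V} \<rightarrow>\<^sub>E tree_restr M k ` code_trees M N"
        using comp by (auto simp: tuple_restr_def)
    qed (use T.finite_restr in \<open>intro finite_PiE; simp\<close>)
    have "(\<lambda>v\<in>{1..V}. \<lambda>i\<in>words M. 1) \<in> tree_tuples M N V"
      using N by (auto simp: tree_tuples_def code_trees_def)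
    then show "tree_tuples M N V \<noteq> {}" by blast
  qed
qed

section \<open>The iterated function system on tuples\<close>

text \<open>A walk from the root of the tree in buffer \<open>v\<close> to the node: every letter
  uses up one index and moves to the buffer chosen for that child. A label depends on finitely many
  indices, one more than the length of its node, so the limit point has an explicit formula.\<close>

primrec code_label :: "nat list \<Rightarrow> (nat \<Rightarrow> nat \<times> (nat \<Rightarrow> nat)) stream \<Rightarrow> nat \<Rightarrow> nat" where
  "code_label [] s v = fst (shd s v)"
| "code_label (m # i) s v = code_label i (stl s) (snd (shd s v) m)"

definition tuple_code ::
    "nat \<Rightarrow> nat \<Rightarrow> (nat \<Rightarrow> nat \<times> (nat \<Rightarrow> nat)) stream \<Rightarrow> nat \<Rightarrow> nat list \<Rightarrow> nat" where
  "tuple_code M V s = (\<lambda>v\<in>{1..V}. \<lambda>i\<in>words M. code_label i s v)"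

lemma tree_ifs_index_fst: "a \<in> tree_ifs_index M N V \<Longrightarrow> v \<in> {1..V} \<Longrightarrow> fst (a v) \<in> {1..N}"
  unfolding tree_ifs_index_def by (drule (1) PiE_mem) (simp only: mem_Times_iff)

lemma tree_ifs_index_snd:
  "a \<in> tree_ifs_index M N V \<Longrightarrow> v \<in> {1..V} \<Longrightarrow> m \<in> {1..M} \<Longrightarrow> snd (a v) m \<in> {1..V}"
  unfolding tree_ifs_index_def
  by (drule (1) PiE_mem, unfold mem_Times_iff, elim conjE, erule (1) PiE_mem)

lemma tree_ifs_map_Nil: "v \<in> {1..V} \<Longrightarrow> tree_ifs_map M V a x v [] = fst (a v)"
  by (simp add: tree_ifs_map_def graft_def)

lemma tree_ifs_map_Cons:
  "v \<in> {1..V} \<Longrightarrow> m # i \<in> words M \<Longrightarrow> tree_ifs_map M V a x v (m # i) = x (snd (a v) m) i"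
  by (simp add: tree_ifs_map_def graft_def)

lemma tree_ifs_map_in:
  assumes a: "a \<in> tree_ifs_index M N V" and x: "x \<in> tree_tuples M N V"
  shows "tree_ifs_map M V a x \<in> tree_tuples M N V"
  unfolding tree_tuples_def code_trees_def
proof (intro PiE_I)
  fix v i assume v: "v \<in> {1..V}" and i: "i \<in> words M"
  show "tree_ifs_map M V a x v i \<in> {1..N}"
  proof (cases i)
    case Nil
    then show ?thesis using tree_ifs_index_fst[OF a v] v by (simp add: tree_ifs_map_Nil)
  next
    case (Cons m j)
    then have "snd (a v) m \<in> {1..V}" using tree_ifs_index_snd[OF a v] i by simp
    then have "x (snd (a v) m) \<in> code_trees M N" using x by (auto simp: tree_tuples_def)
    then have "x (snd (a v) m) j \<in> {1..N}" using i Cons by (auto simp: code_trees_def)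
    then show ?thesis using v i Cons by (simp only: tree_ifs_map_Cons)
  qed
qed (auto simp: tree_ifs_map_def graft_def)

lemma tuple_code_in:
  assumes s: "s \<in> streams (tree_ifs_index M N V)"
  shows "tuple_code M V s \<in> tree_tuples M N V"
proof -
  have "code_label i s v \<in> {1..N}" if "v \<in> {1..V}" "i \<in> words M" for v i
    using s that
  proof (induction i arbitrary: s v)
    case Nil
    then show ?case unfolding code_label.simps by (intro tree_ifs_index_fst streams_shd)
  next
    case (Cons m i)
    have "m \<in> {1..M}" "i \<in> words M" using Cons.prems(3) by simp_all
    then show ?case
      unfolding code_label.simps using Cons.prems
      by (intro Cons.IH tree_ifs_index_snd streams_shd streams_stl)
  qed
  then show ?thesis unfolding tuple_code_def tree_tuples_def code_trees_def by auto
qed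

lemma tuple_code_SCons:
  assumes a: "a \<in> tree_ifs_index M N V" and s: "s \<in> streams (tree_ifs_index M N V)"
  shows "tuple_code M V (a ## s) = tree_ifs_map M V a (tuple_code M V s)"
proof (intro ext)
  fix v i
  show "tuple_code M V (a ## s) v i = tree_ifs_map M V a (tuple_code M V s) v i"
  proof (cases "v \<in> {1..V}")
    case v: True
    show ?thesis
    proof (cases "i \<in> words M")
      case i: True
      show ?thesis
      proof (cases i)
        case Nil
        then show ?thesis using v by (simp add: tree_ifs_map_Nil tuple_code_def)
      next
        case (Cons m j)
        then have "snd (a v) m \<in> {1..V}" using tree_ifs_index_snd[OF a v] i by simp
        then show ?thesis
          using v i Cons by (simp only: tree_ifs_map_Cons) (simp add: tuple_code_def)
      qed
    qed (auto simp: tuple_code_def tree_ifs_map_def graft_def)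
  qed (auto simp: tuple_code_def tree_ifs_map_def)
qed

subsection \<open>Random indices\<close>

text \<open>A map with this collision is determined by its values off \<open>d\<close>. For a
  uniformly random map the collision thus has probability at most 1 / |T|.\<close>

lemma card_PiE_collision:
  assumes D: "finite D" "d \<in> D" "d' \<in> D" "d \<noteq> d'" and T: "finite T" "T \<noteq> {}"
  shows "real (card {F \<in> D \<rightarrow>\<^sub>E T. F d = F d'}) \<le> real (card T) ^ card D / card T"
proof -
  let ?S = "{F \<in> D \<rightarrow>\<^sub>E T. F d = F d'}"
  let ?h = "\<lambda>F. restrict F (D - {d})"
  have "inj_on ?h ?S"
  proof (intro inj_onI PiE_ext)
    fix F G assume F: "F \<in> ?S" and G: "G \<in> ?S" and eq: "?h F = ?h G"
    show "F \<in> D \<rightarrow>\<^sub>E T" "G \<in> D \<rightarrow>\<^sub>E T" using F G by blast+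
    have *: "F x = G x" if "x \<in> D" "x \<noteq> d" for x
      using fun_cong[OF eq, of x] that by simp
    then have "F d' = G d'" using D by metis
    then show "F x = G x" if "x \<in> D" for x using * that F G by (cases "x = d") auto
  qed
  moreover have "?h ` ?S \<subseteq> (D - {d}) \<rightarrow>\<^sub>E T"
  proof (intro image_subsetI)
    fix F assume "F \<in> ?S"
    then show "?h F \<in> (D - {d}) \<rightarrow>\<^sub>E T" by (intro restrict_PiE_iff[THEN iffD2] ballI) (auto dest: PiE_mem)
  qed
  moreover have "finite ((D - {d}) \<rightarrow>\<^sub>E T)" using D T by (intro finite_PiE) auto
  ultimately have "card ?S \<le> card ((D - {d}) \<rightarrow>\<^sub>E T)" by (intro card_inj_on_le)
  also have "\<dots> = card T ^ (card D - 1)" using D by (simp add: card_funcsetE)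
  finally have "real (card ?S) \<le> real (card T) ^ (card D - 1)"
    by (simp only: of_nat_le_iff flip: of_nat_power)
  also have "\<dots> = real (card T) ^ card D / card T"
  proof -
    have "card D > 0" using D card_gt_0_iff by blast
    then have "real (card T) ^ card D = real (card T) ^ (card D - 1) * card T"
      by (simp only: power_minus_mult)
    then show ?thesis using T by simp
  qed
  finally show ?thesis .
qed

text \<open>A union bound over the pairs of points of \<open>D'\<close>.\<close>

lemma card_inj_on_PiE_ge:
  assumes D: "finite D" and sub: "D' \<subseteq> D" and T: "finite T" "T \<noteq> {}"
  shows "(1 - (real (card D'))\<^sup>2 / (2 * real (card T))) * real (card T) ^ card D
    \<le> real (card {F \<in> D \<rightarrow>\<^sub>E T. inj_on F D'})"
proof -
  let ?A = "\<lambda>D'. {F \<in> D \<rightarrow>\<^sub>E T. inj_on F D'}" and ?V = "real (card T)"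
  have fin: "finite (D \<rightarrow>\<^sub>E T)" using D T by (intro finite_PiE) auto
  have V: "?V > 0" using T by (simp add: card_gt_0_iff)
  have "finite D'" using sub D finite_subset by blast
  \<comment> \<open>The induction uses the exact number n (n - 1) / 2 of pairs, since a new point
    adds \<open>n\<close> pairs; it is relaxed to n^2 / 2 at the end.\<close>
  then have "(1 - real (card D') * (real (card D') - 1) / (2 * ?V)) * ?V ^ card D
    \<le> real (card (?A D'))"
    using sub
  proof (induction D' rule: finite_induct)
    case empty
    then show ?case using D by (simp add: card_funcsetE)
  next
    case (insert d D')
    let ?n = "real (card D')"
    let ?B = "\<lambda>d'. {F \<in> D \<rightarrow>\<^sub>E T. F d = F d'}"
    have "?A D' \<subseteq> ?A (insert d D') \<union> (\<Union>d'\<in>D'. ?B d')"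
      by auto
    then have "card (?A D') \<le> card (?A (insert d D') \<union> (\<Union>d'\<in>D'. ?B d'))"
      using fin insert.hyps(1) by (intro card_mono) auto
    also have "\<dots> \<le> card (?A (insert d D')) + card (\<Union>d'\<in>D'. ?B d')" by (rule card_Un_le)
    also have "card (\<Union>d'\<in>D'. ?B d') \<le> (\<Sum>d'\<in>D'. card (?B d'))"
      using insert.hyps(1) by (rule card_UN_le)
    finally have "card (?A D') \<le> card (?A (insert d D')) + (\<Sum>d'\<in>D'. card (?B d'))" by simp
    then have "real (card (?A D')) \<le> real (card (?A (insert d D'))) + (\<Sum>d'\<in>D'. real (card (?B d')))"
      by (simp only: of_nat_le_iff flip: of_nat_sum of_nat_add)
    also have "(\<Sum>d'\<in>D'. real (card (?B d'))) \<le> (\<Sum>d'\<in>D'. ?V ^ card D / card T)"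
      using insert.hyps insert.prems by (intro sum_mono card_PiE_collision D T) auto
    finally have "real (card (?A D')) \<le> real (card (?A (insert d D'))) + ?n * (?V ^ card D / ?V)"
      by simp
    moreover have "(1 - ?n * (?n - 1) / (2 * ?V)) * ?V ^ card D \<le> real (card (?A D'))"
      using insert.IH insert.prems by blast
    moreover have "(1 - (?n + 1) * ?n / (2 * ?V)) * ?V ^ card D
        = (1 - ?n * (?n - 1) / (2 * ?V)) * ?V ^ card D - ?n * (?V ^ card D / ?V)"
      using V by (simp add: field_simps)
    ultimately show ?case using insert.hyps by (simp add: add.commute)
  qed
  moreover have "(1 - (real (card D'))\<^sup>2 / (2 * ?V)) * ?V ^ card D
      \<le> (1 - real (card D') * (real (card D') - 1) / (2 * ?V)) * ?V ^ card D"
    using V by (intro mult_right_mono diff_left_mono divide_right_mono)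
      (auto simp: power2_eq_square algebra_simps)
  ultimately show ?thesis by linarith
qed

text \<open>Injectivity of \<open>e\<close> puts the prescriptions on distinct coordinates. Each of
  these contributes one factor, and each free coordinate sums to 1.\<close>

lemma sum_labels:
  fixes P :: "nat \<Rightarrow> real" and e \<kappa> :: "'j \<Rightarrow> nat"
  assumes J: "finite J" "inj_on e J" "e ` J \<subseteq> {1..V}" and \<kappa>: "\<kappa> ` J \<subseteq> {1..N}"
    and P: "(\<Sum>n\<in>{1..N}. P n) = 1"
  shows "(\<Sum>n\<in>{n \<in> {1..V} \<rightarrow>\<^sub>E {1..N}. \<forall>j\<in>J. n (e j) = \<kappa> j}. \<Prod>v\<in>{1..V}. P (n v)) = (\<Prod>j\<in>J. P (\<kappa> j))"
proof -
  define B where "B v = (if v \<in> e ` J then {\<kappa> (inv_into J e v)} else {1..N})" for v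
  have "{n \<in> {1..V} \<rightarrow>\<^sub>E {1..N}. \<forall>j\<in>J. n (e j) = \<kappa> j} = PiE {1..V} B"
  proof (intro subset_antisym subsetI)
    fix n assume "n \<in> {n \<in> {1..V} \<rightarrow>\<^sub>E {1..N}. \<forall>j\<in>J. n (e j) = \<kappa> j}"
    then show "n \<in> PiE {1..V} B" using J(2) by (auto simp: B_def PiE_iff)
  next
    fix n assume n: "n \<in> PiE {1..V} B"
    have "n (e j) = \<kappa> j" if "j \<in> J" for j
      using PiE_mem[OF n, of "e j"] that J by (auto simp: B_def)
    moreover have "B v \<subseteq> {1..N}" if "v \<in> {1..V}" for v
      using \<kappa> inv_into_into[of v e J] unfolding B_def by (cases "v \<in> e ` J") force+
    then have "n \<in> {1..V} \<rightarrow>\<^sub>E {1..N}" using n PiE_mono[of "{1..V}" B "\<lambda>_. {1..N}"] by blast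
    ultimately show "n \<in> {n \<in> {1..V} \<rightarrow>\<^sub>E {1..N}. \<forall>j\<in>J. n (e j) = \<kappa> j}" by blast
  qed
  then have "(\<Sum>n\<in>{n \<in> {1..V} \<rightarrow>\<^sub>E {1..N}. \<forall>j\<in>J. n (e j) = \<kappa> j}. \<Prod>v\<in>{1..V}. P (n v))
      = (\<Prod>v\<in>{1..V}. \<Sum>n\<in>B v. P n)"
    by (subst prod_sum_PiE) (simp_all add: B_def)
  also have "\<dots> = (\<Prod>v\<in>e ` J. \<Sum>n\<in>B v. P n)"
    using J P by (intro prod.mono_neutral_right) (auto simp: B_def)
  also have "\<dots> = (\<Prod>j\<in>J. P (\<kappa> j))"
    using J by (simp add: prod.reindex B_def)
  finally show ?thesis .
qed

definition index_labels :: "nat \<Rightarrow> (nat \<Rightarrow> nat \<times> (nat \<Rightarrow> nat)) \<Rightarrow> nat \<Rightarrow> nat" where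
  "index_labels V a = (\<lambda>v\<in>{1..V}. fst (a v))"

text \<open>The choices are flattened to one map on pairs (buffer, child), so that the count of
  injective maps applies to them.\<close>

definition index_choices :: "nat \<Rightarrow> nat \<Rightarrow> (nat \<Rightarrow> nat \<times> (nat \<Rightarrow> nat)) \<Rightarrow> nat \<times> nat \<Rightarrow> nat" where
  "index_choices M V a = (\<lambda>vm\<in>{1..V} \<times> {1..M}. snd (a (fst vm)) (snd vm))"

text \<open>Under \<open>tree_ifs_prob\<close> the labels are independent of the buffer choices, and the latter are
  uniformly distributed.\<close>

lemma sum_tree_ifs_prob:
  "(\<Sum>a\<in>{a \<in> tree_ifs_index M N V. X (index_labels V a) \<and> Z (index_choices M V a)}. tree_ifs_prob M V P a)
   = (\<Sum>n\<in>{n \<in> {1..V} \<rightarrow>\<^sub>E {1..N}. X n}. \<Prod>v\<in>{1..V}. P (n v)) *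
     (real (card {F \<in> {1..V} \<times> {1..M} \<rightarrow>\<^sub>E {1..V}. Z F}) / real V ^ (M * V))"
proof -
  let ?S = "{a \<in> tree_ifs_index M N V. X (index_labels V a) \<and> Z (index_choices M V a)}"
  let ?L = "{n \<in> {1..V} \<rightarrow>\<^sub>E {1..N}. X n}" and ?C = "{F \<in> {1..V} \<times> {1..M} \<rightarrow>\<^sub>E {1..V}. Z F}"
  let ?j = "\<lambda>a. (index_labels V a, index_choices M V a)"
  let ?i = "\<lambda>(n, F). \<lambda>v\<in>{1..V}. (n v, \<lambda>m\<in>{1..M}. F (v, m))"
  let ?w = "\<lambda>n. \<Prod>v\<in>{1..V}. P (n v)"
  have "(\<Sum>a\<in>?S. tree_ifs_prob M V P a) = (\<Sum>(n, F)\<in>?L \<times> ?C. ?w n / real V ^ (M * V))"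
  proof (rule sum.reindex_bij_witness[where i="?i" and j="?j"])
    fix a assume a: "a \<in> ?S"
    then have aI: "a \<in> tree_ifs_index M N V" by blast
    show "?i (?j a) = a"
    proof
      fix v
      show "?i (?j a) v = a v"
      proof (cases "v \<in> {1..V}")
        case True
        have "a v \<in> {1..N} \<times> ({1..M} \<rightarrow>\<^sub>E {1..V})"
          using aI True unfolding tree_ifs_index_def by (rule PiE_mem)
        then have "snd (a v) \<in> {1..M} \<rightarrow>\<^sub>E {1..V}" by (simp only: mem_Times_iff)
        then have "(\<lambda>m\<in>{1..M}. snd (a v) m) = snd (a v)" by (rule PiE_restrict)
        then show ?thesis
          using True by (simp add: index_labels_def index_choices_def cong: restrict_cong)
      next
        case False
        then show ?thesis using aI by (auto simp: tree_ifs_index_def PiE_def extensional_def)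
      qed
    qed
    have "index_labels V a \<in> {1..V} \<rightarrow>\<^sub>E {1..N}"
      unfolding index_labels_def using tree_ifs_index_fst[OF aI] by (intro restrict_PiE_iff[THEN iffD2] ballI)
    moreover have "index_choices M V a \<in> {1..V} \<times> {1..M} \<rightarrow>\<^sub>E {1..V}"
      unfolding index_choices_def using tree_ifs_index_snd[OF aI]
      by (intro restrict_PiE_iff[THEN iffD2] ballI) (simp only: mem_Times_iff)
    ultimately show "?j a \<in> ?L \<times> ?C" using a by blast
    show "(case ?j a of (n, F) \<Rightarrow> ?w n / real V ^ (M * V)) = tree_ifs_prob M V P a"
      by (simp add: tree_ifs_prob_def index_labels_def)
  next
    fix nF assume "nF \<in> ?L \<times> ?C"
    then obtain n F where nF: "nF = (n, F)" "n \<in> ?L" "F \<in> ?C" by blast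
    have n: "n \<in> {1..V} \<rightarrow>\<^sub>E {1..N}" and F: "F \<in> {1..V} \<times> {1..M} \<rightarrow>\<^sub>E {1..V}" using nF by blast+
    have labels: "index_labels V (?i (n, F)) = n"
    proof -
      have "index_labels V (?i (n, F)) = restrict n {1..V}"
        by (simp add: index_labels_def cong: restrict_cong)
      then show ?thesis using PiE_restrict[OF n] by simp
    qed
    have choices: "index_choices M V (?i (n, F)) = F"
    proof -
      have "index_choices M V (?i (n, F)) = restrict F ({1..V} \<times> {1..M})"
        unfolding index_choices_def by (intro restrict_cong refl) auto
      then show ?thesis using PiE_restrict[OF F] by simp
    qed
    show "?j (?i nF) = nF" using nF labels choices by simp
    have "?i (n, F) \<in> tree_ifs_index M N V"
      unfolding tree_ifs_index_def using n F by auto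
    then show "?i nF \<in> ?S" using nF labels choices by simp
  qed
  also have "\<dots> = (\<Sum>n\<in>?L. \<Sum>F\<in>?C. ?w n / real V ^ (M * V))"
    by (rule sum.cartesian_product[symmetric])
  also have "\<dots> = (\<Sum>n\<in>?L. ?w n) * (real (card ?C) / real V ^ (M * V))"
  proof -
    have "(\<Sum>F\<in>?C. ?w n / real V ^ (M * V)) = ?w n * (real (card ?C) / real V ^ (M * V))" for n
      by simp
    then show ?thesis by (simp only: sum_distrib_right)
  qed
  finally show ?thesis .
qed

lemma sum_tree_ifs_prob_eq_1:
  assumes V: "V \<ge> 1" and P: "(\<Sum>n\<in>{1..N}. P n) = 1"
  shows "(\<Sum>a\<in>tree_ifs_index M N V. tree_ifs_prob M V P a) = 1"
  using sum_tree_ifs_prob[where X="\<lambda>_. True" and Z="\<lambda>_. True" and M=M and N=N and V=V and P=P]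
    sum_labels[where J="{}" and V=V and N=N and P=P] P V
  by (simp add: card_funcsetE card_cartesian_product mult.commute)

subsection \<open>Following a given tree\<close>

lemma level_Suc_iff: "w \<in> level M (Suc l) \<longleftrightarrow> (\<exists>j\<in>level M l. \<exists>m\<in>{1..M}. w = j @ [m])"
proof
  assume w: "w \<in> level M (Suc l)"
  then have "w \<noteq> []" by (auto simp: level_def)
  then have "w = butlast w @ [last w]" by simp
  then have "butlast w @ [last w] \<in> level M (Suc l)" using w by simp
  then have "butlast w \<in> level M l" "last w \<in> {1..M}" by (auto simp: level_def)
  then show "\<exists>j\<in>level M l. \<exists>m\<in>{1..M}. w = j @ [m]"
    using \<open>w = butlast w @ [last w]\<close> by blast
qed (auto simp: level_def)

text \<open>If the buffer \<open>e j\<close> is to hold the subtree at the node \<open>j\<close> of level \<open>l\<close>, then the choices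
  made by the index \<open>a\<close> determine the buffers for the nodes of the next level.\<close>

definition child_buffer ::
    "(nat list \<Rightarrow> nat) \<Rightarrow> (nat \<Rightarrow> nat \<times> (nat \<Rightarrow> nat)) \<Rightarrow> nat list \<Rightarrow> nat" where
  "child_buffer e a w = snd (a (e (butlast w))) (last w)"

section \<open>The tree system as an instance of the abstract one, and agreement below a
  level\<close>

locale V_variable_system =
  fixes M N V :: nat and P :: "nat \<Rightarrow> real"
  assumes M: "M \<ge> 2" and N: "N \<ge> 1" and V: "V \<ge> 1"
    and P_nonneg: "\<And>n. n \<in> {1..N} \<Longrightarrow> 0 \<le> P n" and P_sum: "(\<Sum>n\<in>{1..N}. P n) = 1"
begin

sublocale T: level_metric "code_trees M N" "tree_dist M" M "tree_restr M"
  using M N by (rule level_metric_trees)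

sublocale level_ifs "tree_tuples M N V" "tuple_dist M V" M "tuple_restr M V"
  "tree_ifs_index M N V" "tree_ifs_map M V" "tuple_code M V" "tree_ifs_prob M V P"
proof -
  interpret level_metric "tree_tuples M N V" "tuple_dist M V" M "tuple_restr M V"
    using M N V by (rule level_metric_tuples)
  show "level_ifs (tree_tuples M N V) (tuple_dist M V) M (tuple_restr M V)
    (tree_ifs_index M N V) (tree_ifs_map M V) (tuple_code M V) (tree_ifs_prob M V P)"
  proof
    show "finite (tree_ifs_index M N V)"
      unfolding tree_ifs_index_def by (intro finite_PiE finite_cartesian_product; simp)
    show "tree_ifs_index M N V \<noteq> {}"
      using N V by (auto simp: tree_ifs_index_def PiE_eq_empty_iff)
    show "(\<Sum>a\<in>tree_ifs_index M N V. tree_ifs_prob M V P a) = 1"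
      using V P_sum by (rule sum_tree_ifs_prob_eq_1)
    show "0 \<le> tree_ifs_prob M V P a" if "a \<in> tree_ifs_index M N V" for a
      unfolding tree_ifs_prob_def
      by (intro divide_nonneg_nonneg prod_nonneg ballI P_nonneg tree_ifs_index_fst[OF that]) simp_all
    fix a x y k
    assume a: "a \<in> tree_ifs_index M N V" and eq: "tuple_restr M V k x = tuple_restr M V k y"
    show "tuple_restr M V (Suc k) (tree_ifs_map M V a x) = tuple_restr M V (Suc k) (tree_ifs_map M V a y)"
      unfolding tuple_restr_eq_iff tree_restr_eq_iff
    proof (intro ballI)
      fix v i assume v: "v \<in> {1..V}" and i: "i \<in> levels M 0 (Suc k)"
      show "tree_ifs_map M V a x v i = tree_ifs_map M V a y v i"
      proof (cases i)
        case Nil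
        then show ?thesis using v by (simp add: tree_ifs_map_Nil)
      next
        case (Cons m j)
        have j: "m # j \<in> words M" "m \<in> {1..M}" "j \<in> levels M 0 k"
          using i Cons by (auto simp: mem_levels_iff)
        have "snd (a v) m \<in> {1..V}" using a v j(2) by (rule tree_ifs_index_snd)
        then have "x (snd (a v) m) j = y (snd (a v) m) j"
          using eq j(3) unfolding tuple_restr_eq_iff tree_restr_eq_iff by blast
        then show ?thesis using v j(1) Cons by (simp add: tree_ifs_map_Cons)
      qed
    qed
  qed (use tree_ifs_map_in tuple_code_in tuple_code_SCons in blast)+
qed

text \<open>The buffer \<open>e j\<close> is to agree for \<open>k\<close> levels with the subtree
  of \<open>\<kappa>\<close> at the node \<open>j\<close>. All nodes of level \<open>l\<close> enter
  one event, because the buffers are driven by the same indices.\<close>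

definition matching :: "nat \<Rightarrow> nat \<Rightarrow> (nat list \<Rightarrow> nat) \<Rightarrow> (nat list \<Rightarrow> nat) \<Rightarrow> (nat \<Rightarrow> nat list \<Rightarrow> nat) set" where
  "matching l k e \<kappa> = {x \<in> tree_tuples M N V. \<forall>j\<in>level M l. \<forall>i\<in>levels M 0 k. x (e j) i = \<kappa> (j @ i)}"

lemma matching_0 [simp]: "matching l 0 e \<kappa> = tree_tuples M N V"
  by (simp add: matching_def)

lemma matching_cong:
  "(\<And>j. j \<in> level M l \<Longrightarrow> e j = e' j) \<Longrightarrow> matching l k e \<kappa> = matching l k e' \<kappa>"
  by (auto simp: matching_def)

lemma matching_in_sets:
  assumes e: "e \<in> level M l \<rightarrow> {1..V}"
  shows "matching l k e \<kappa> \<in> sets (borel_sigma (tree_tuples M N V) (tuple_dist M V))"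
proof -
  have "matching l k e \<kappa> = {x \<in> tree_tuples M N V.
      \<forall>j\<in>level M l. \<forall>i\<in>levels M 0 k. tuple_restr M V k x (e j) i = \<kappa> (j @ i)}"
    unfolding matching_def
    by (intro Collect_cong conj_cong ball_cong refl)
      (use e in \<open>simp add: tuple_restr_def tree_restr_def Pi_iff del: atLeastAtMost_iff\<close>)
  also have "\<dots> \<in> sets (borel_sigma (tree_tuples M N V) (tuple_dist M V))"
    by (rule restr_Collect_in_sets)
  finally show ?thesis .
qed

lemma child_buffer_in:
  assumes "a \<in> tree_ifs_index M N V" "e \<in> level M l \<rightarrow> {1..V}"
  shows "child_buffer e a \<in> level M (Suc l) \<rightarrow> {1..V}"
proof
  fix w assume "w \<in> level M (Suc l)"
  then obtain j m where "j \<in> level M l" "m \<in> {1..M}" "w = j @ [m]" unfolding level_Suc_iff by blast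
  then have "e j \<in> {1..V}" "child_buffer e a w = snd (a (e j)) m"
    using assms by (auto simp: child_buffer_def)
  then show "child_buffer e a w \<in> {1..V}"
    using tree_ifs_index_snd[OF assms(1) _ \<open>m \<in> {1..M}\<close>] by metis
qed

text \<open>The index supplies the labels of level \<open>l\<close>, and the point \<open>x\<close>
  everything below. This is the induction step shared by both estimates.\<close>

lemma tree_ifs_map_matching:
  assumes a: "a \<in> tree_ifs_index M N V" and e: "e \<in> level M l \<rightarrow> {1..V}"
    and labels: "\<forall>j\<in>level M l. fst (a (e j)) = \<kappa> j"
    and x: "x \<in> matching (Suc l) k (child_buffer e a) \<kappa>"
  shows "tree_ifs_map M V a x \<in> matching l (Suc k) e \<kappa>"
  unfolding matching_def
proof (intro CollectI conjI ballI)
  show "tree_ifs_map M V a x \<in> tree_tuples M N V"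
    using a x by (auto simp: matching_def intro: tree_ifs_map_in)
  fix j i assume j: "j \<in> level M l" and i: "i \<in> levels M 0 (Suc k)"
  have ej: "e j \<in> {1..V}" using e j by blast
  show "tree_ifs_map M V a x (e j) i = \<kappa> (j @ i)"
  proof (cases i)
    case Nil
    then show ?thesis using labels j ej by (simp add: tree_ifs_map_Nil)
  next
    case (Cons m i')
    have i': "m # i' \<in> words M" "m \<in> {1..M}" "i' \<in> levels M 0 k"
      using i Cons by (auto simp: mem_levels_iff)
    have "j @ [m] \<in> level M (Suc l)" unfolding level_Suc_iff using j i'(2) by blast
    then have "x (child_buffer e a (j @ [m])) i' = \<kappa> ((j @ [m]) @ i')"
      using x i'(3) unfolding matching_def by blast
    then show ?thesis using ej i'(1) Cons by (simp add: tree_ifs_map_Cons child_buffer_def)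
  qed
qed

subsection \<open>The Hausdorff estimate\<close>

text \<open>Distinct buffers can receive their labels and the buffers of their children without
  conflict, so any assignment \<open>e'\<close> for the next level can be realized.\<close>

lemma ex_index:
  assumes e: "e \<in> level M l \<rightarrow> {1..V}" "inj_on e (level M l)"
    and e': "e' \<in> level M (Suc l) \<rightarrow> {1..V}" and \<kappa>: "\<kappa> \<in> code_trees M N"
  obtains a where "a \<in> tree_ifs_index M N V" "\<forall>j\<in>level M l. fst (a (e j)) = \<kappa> j"
    "\<And>w. w \<in> level M (Suc l) \<Longrightarrow> child_buffer e a w = e' w"
proof
  let ?inv = "inv_into (level M l) e"
  \<comment> \<open>Buffers that hold no node of level \<open>l\<close> get an arbitrary admissible
    entry.\<close>
  let ?a = "\<lambda>v\<in>{1..V}. if v \<in> e ` level M l then (\<kappa> (?inv v), \<lambda>m\<in>{1..M}. e' (?inv v @ [m]))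
    else (1, \<lambda>m\<in>{1..M}. 1)"
  have \<kappa>': "\<kappa> j \<in> {1..N}" if "j \<in> level M l" for j
    using \<kappa> that unfolding code_trees_def level_def by blast
  have e'': "e' (j @ [m]) \<in> {1..V}" if "j \<in> level M l" "m \<in> {1..M}" for j m
    using e' that level_Suc_iff by blast
  have val: "?a (e j) = (\<kappa> j, \<lambda>m\<in>{1..M}. e' (j @ [m]))" if "j \<in> level M l" for j
  proof -
    have "e j \<in> {1..V}" using e(1) that by blast
    then show ?thesis using that e(2) by (simp del: atLeastAtMost_iff)
  qed
  show "?a \<in> tree_ifs_index M N V"
    unfolding tree_ifs_index_def
  proof (intro restrict_PiE_iff[THEN iffD2] ballI)
    fix v assume v: "v \<in> {1..V}"
    show "(if v \<in> e ` level M l then (\<kappa> (?inv v), \<lambda>m\<in>{1..M}. e' (?inv v @ [m])) else (1, \<lambda>m\<in>{1..M}. 1))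
      \<in> {1..N} \<times> ({1..M} \<rightarrow>\<^sub>E {1..V})"
    proof (cases "v \<in> e ` level M l")
      case True
      then have "?inv v \<in> level M l" by (rule inv_into_into)
      then have "(\<kappa> (?inv v), \<lambda>m\<in>{1..M}. e' (?inv v @ [m])) \<in> {1..N} \<times> ({1..M} \<rightarrow>\<^sub>E {1..V})"
        by (intro SigmaI \<kappa>' restrict_PiE_iff[THEN iffD2] ballI e'')
      then show ?thesis using True by (simp only: if_True)
    qed (use N V in \<open>auto simp: restrict_PiE_iff\<close>)
  qed
  show "\<forall>j\<in>level M l. fst (?a (e j)) = \<kappa> j" using val by simp
  fix w assume "w \<in> level M (Suc l)"
  then obtain j m where w: "j \<in> level M l" "m \<in> {1..M}" "w = j @ [m]" unfolding level_Suc_iff by blast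
  then show "child_buffer e ?a w = e' w"
    unfolding child_buffer_def using val[OF w(1)] by (simp del: atLeastAtMost_iff)
qed

text \<open>Labels are prescribed on levels \<open>l\<close> to l + k - 1, so the last of these must
  fit into \<open>V\<close> buffers. For \<open>k = 0\<close> nothing is prescribed and
  \<open>e\<close> may be arbitrary; this admits a final step to a level with more than
  \<open>V\<close> nodes.\<close>

lemma attractor_matching:
  assumes "\<kappa> \<in> code_trees M N" "e \<in> level M l \<rightarrow> {1..V}"
    and "k = 0 \<or> inj_on e (level M l)" "k = 0 \<or> M ^ (l + k - 1) \<le> V"
  shows "\<exists>x\<in>V_variable_tuples M N V. x \<in> matching l k e \<kappa>"
  using assms
proof (induction k arbitrary: l e)
  case 0
  then show ?case
    using set_attractor_invariant(2,3) unfolding V_variable_tuples_def matching_0 by blast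
next
  case (Suc k)
  have "\<exists>e' \<in> level M (Suc l) \<rightarrow> {1..V}. k = 0 \<or> inj_on e' (level M (Suc l))"
  proof (cases "k = 0")
    case True
    have "(\<lambda>_. 1) \<in> level M (Suc l) \<rightarrow> {1..V}" using V by simp
    then show ?thesis using True by blast
  next
    case False
    have "M ^ Suc l \<le> M ^ (l + Suc k - 1)" using M False by (intro power_increasing) auto
    then have "card (level M (Suc l)) \<le> card {1..V}" using Suc.prems(4) by simp
    then obtain e' where "e' ` level M (Suc l) \<subseteq> {1..V}" "inj_on e' (level M (Suc l))"
      using card_le_inj[of "level M (Suc l)" "{1..V}"] by auto
    then show ?thesis by blast
  qed
  then obtain e' where e': "e' \<in> level M (Suc l) \<rightarrow> {1..V}" "k = 0 \<or> inj_on e' (level M (Suc l))"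
    by blast
  obtain x where x: "x \<in> V_variable_tuples M N V" "x \<in> matching (Suc l) k e' \<kappa>"
    using Suc.IH[OF Suc.prems(1) e'] Suc.prems(4) by auto
  obtain a where a: "a \<in> tree_ifs_index M N V" "\<forall>j\<in>level M l. fst (a (e j)) = \<kappa> j"
    "\<And>w. w \<in> level M (Suc l) \<Longrightarrow> child_buffer e a w = e' w"
    using ex_index[OF Suc.prems(2) _ e'(1) Suc.prems(1)] Suc.prems(3) by blast
  have "x \<in> matching (Suc l) k (child_buffer e a) \<kappa>"
    using x(2) matching_cong[of "Suc l" "child_buffer e a" e', OF a(3)] by simp
  then have "tree_ifs_map M V a x \<in> matching l (Suc k) e \<kappa>"
    by (rule tree_ifs_map_matching[OF a(1) Suc.prems(2) a(2)])
  moreover have "tree_ifs_map M V a x \<in> V_variable_tuples M N V"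
    using x(1) a(1) set_attractor_invariant(1) unfolding V_variable_tuples_def by blast
  ultimately show ?case by blast
qed

lemma matching_root_iff:
  "x \<in> matching 0 k (\<lambda>_. 1) \<kappa> \<longleftrightarrow>
     x \<in> tree_tuples M N V \<and> tree_restr M k (x 1) = tree_restr M k \<kappa>"
  by (simp add: matching_def tree_restr_eq_iff)

lemma first_tree_in: "x \<in> tree_tuples M N V \<Longrightarrow> x 1 \<in> code_trees M N"
  using V by (auto simp: tree_tuples_def)

lemma hausdorff_dist_V_variable_trees:
  "hausdorff_dist (tree_dist M) (V_variable_trees M N V) (code_trees M N) < 1 / real V"
  "0 \<le> hausdorff_dist (tree_dist M) (V_variable_trees M N V) (code_trees M N)"
proof -
  obtain k where k: "M ^ k \<le> V" "V < M ^ Suc k" using ex_power_ivl1[OF M V] by auto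
  have sub: "V_variable_trees M N V \<subseteq> code_trees M N" and ne: "V_variable_trees M N V \<noteq> {}"
    using set_attractor_invariant(2,3) first_tree_in
    unfolding V_variable_trees_def V_variable_tuples_def by blast+
  have dense: "\<exists>\<omega>\<in>V_variable_trees M N V. tree_restr M (Suc k) \<omega> = tree_restr M (Suc k) \<kappa>"
    if "\<kappa> \<in> code_trees M N" for \<kappa>
  proof -
    obtain x where "x \<in> V_variable_tuples M N V" "x \<in> matching 0 (Suc k) (\<lambda>_. 1) \<kappa>"
      using attractor_matching[OF \<open>\<kappa> \<in> code_trees M N\<close>, of "\<lambda>_. 1" 0 "Suc k"] k(1) V by auto
    then show ?thesis unfolding V_variable_trees_def matching_root_iff by blast
  qed
  note bounds = T.hausdorff_dist_bounds[OF sub ne dense]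
  \<comment> \<open>Levels 0 to \<open>k\<close> make up depth k + 1, hence the radius 1 / M^(k +
    1); the choice of \<open>k\<close> makes the inequality strict.\<close>
  have "real V < real M ^ Suc k" using k(2) by (simp only: of_nat_less_iff flip: of_nat_power)
  then have "1 / real M ^ Suc k < 1 / real V" using V M by (intro divide_strict_left_mono) auto
  with bounds(1) show "hausdorff_dist (tree_dist M) (V_variable_trees M N V) (code_trees M N) < 1 / real V"
    by linarith
  show "0 \<le> hausdorff_dist (tree_dist M) (V_variable_trees M N V) (code_trees M N)"
    by (rule bounds(2))
qed

end

section \<open>The Monge--Kantorovich estimate\<close>

context V_variable_system
begin

text \<open>A union bound: some two of the buffers chosen for the \<open>n = M ^ t\<close> nodes of level \<open>t\<close>
  coincide with probability at most \<open>n\<^sup>2 / (2 * V)\<close>. Level \<open>l\<close> itself does not contribute, since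
  its buffers are given.\<close>

definition collision_bound :: "nat \<Rightarrow> nat \<Rightarrow> real" where
  "collision_bound l k = (\<Sum>t\<in>{l<..<l + k}. (real M ^ t)\<^sup>2 / (2 * real V))"

lemma collision_bound_nonneg: "0 \<le> collision_bound l k"
  unfolding collision_bound_def by (intro sum_nonneg) simp

text \<open>For \<open>k = 0\<close> no label below level \<open>l\<close> is tested, so the buffers
  of level l + 1 may coincide at no cost.\<close>

lemma collision_bound_Suc:
  "collision_bound l (Suc k)
    = (if k = 0 then 0 else (real M ^ Suc l)\<^sup>2 / (2 * real V)) + collision_bound (Suc l) k"
proof (cases k)
  case (Suc k')
  have "{l<..<l + Suc k} = insert (Suc l) {Suc l<..<Suc l + k}" using Suc by auto
  then show ?thesis using Suc by (simp add: collision_bound_def)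
next
  case 0
  have "{l<..<Suc l} = {}" by auto
  then show ?thesis using 0 by (simp add: collision_bound_def)
qed

text \<open>An index is good if it places the right labels on level \<open>l\<close> and, when
  further labels remain to be tested, sends the children to distinct buffers. Labels and choices are
  independent, so the weight is a product: exact for the labels, estimated by the union bound for
  the choices.\<close>

lemma good_index_prob:
  assumes e: "e \<in> level M l \<rightarrow> {1..V}" "inj_on e (level M l)" and \<kappa>: "\<kappa> \<in> code_trees M N"
  obtains G where "G \<subseteq> tree_ifs_index M N V"
    "\<And>a. a \<in> G \<Longrightarrow> \<forall>j\<in>level M l. fst (a (e j)) = \<kappa> j"
    "\<And>a. a \<in> G \<Longrightarrow> k = 0 \<or> inj_on (child_buffer e a) (level M (Suc l))"
    "(1 - (if k = 0 then 0 else (real M ^ Suc l)\<^sup>2 / (2 * real V))) * (\<Prod>j\<in>level M l. P (\<kappa> j))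
      \<le> (\<Sum>a\<in>G. tree_ifs_prob M V P a)"
proof
  \<comment> \<open>The slots (buffer, child number) of the nodes of level l + 1; there are M^(l +
    1) of them because \<open>e\<close> is injective.\<close>
  let ?D = "e ` level M l \<times> {1..M}"
  let ?X = "\<lambda>n. \<forall>j\<in>level M l. n (e j) = \<kappa> j"
  let ?Z = "\<lambda>F. k = 0 \<or> inj_on F ?D"
  let ?G = "{a \<in> tree_ifs_index M N V. ?X (index_labels V a) \<and> ?Z (index_choices M V a)}"
  let ?Q = "\<Prod>j\<in>level M l. P (\<kappa> j)"
  have ev: "e j \<in> {1..V}" if "j \<in> level M l" for j using e(1) that by blast
  have \<kappa>N: "\<kappa> j \<in> {1..N}" if "j \<in> level M l" for j
    using \<kappa> that unfolding code_trees_def level_def by blast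
  show "?G \<subseteq> tree_ifs_index M N V" by blast
  show "\<forall>j\<in>level M l. fst (a (e j)) = \<kappa> j" if "a \<in> ?G" for a
    using that ev by (simp add: index_labels_def del: atLeastAtMost_iff)
  show "k = 0 \<or> inj_on (child_buffer e a) (level M (Suc l))" if a: "a \<in> ?G" for a
  proof (cases "k = 0")
    case False
    then have inj: "inj_on (index_choices M V a) ?D" using a by blast
    have choice: "index_choices M V a (e j, m) = child_buffer e a (j @ [m])"
      if "j \<in> level M l" "m \<in> {1..M}" for j m
      using ev[OF that(1)] that(2)
      by (simp add: index_choices_def child_buffer_def mem_Times_iff del: atLeastAtMost_iff)
    have "inj_on (child_buffer e a) (level M (Suc l))"
    proof (rule inj_onI)
      fix u w assume "u \<in> level M (Suc l)" "w \<in> level M (Suc l)"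
        and eq: "child_buffer e a u = child_buffer e a w"
      then obtain i m j n where u: "i \<in> level M l" "m \<in> {1..M}" "u = i @ [m]"
        and w: "j \<in> level M l" "n \<in> {1..M}" "w = j @ [n]"
        unfolding level_Suc_iff by blast
      have "index_choices M V a (e i, m) = index_choices M V a (e j, n)"
        using eq choice u w by simp
      moreover have "(e i, m) \<in> ?D" "(e j, n) \<in> ?D" using u w by blast+
      ultimately have "(e i, m) = (e j, n)" using inj by (rule inj_onD[rotated 1])
      then show "u = w" using u w inj_onD[OF e(2)] by blast
    qed
    then show ?thesis by blast
  qed blast
  have labels: "(\<Sum>n\<in>{n \<in> {1..V} \<rightarrow>\<^sub>E {1..N}. ?X n}. \<Prod>v\<in>{1..V}. P (n v)) = ?Q"
    using ev \<kappa>N e(2) P_sum by (intro sum_labels) auto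
  have choices: "1 - (if k = 0 then 0 else (real M ^ Suc l)\<^sup>2 / (2 * real V))
    \<le> real (card {F \<in> {1..V} \<times> {1..M} \<rightarrow>\<^sub>E {1..V}. ?Z F}) / real V ^ (M * V)"
  proof (cases "k = 0")
    case True
    then show ?thesis using V by (simp add: card_funcsetE card_cartesian_product mult.commute)
  next
    case False
    have card_D: "card ?D = M ^ Suc l"
      using e(2) by (simp add: card_cartesian_product card_image mult.commute)
    have "(1 - (real (card ?D))\<^sup>2 / (2 * real (card {1..V}))) * real (card {1..V}) ^ card ({1..V} \<times> {1..M})
      \<le> real (card {F \<in> {1..V} \<times> {1..M} \<rightarrow>\<^sub>E {1..V}. inj_on F ?D})"
      by (rule card_inj_on_PiE_ge) (use ev V in auto)
    then have "(1 - (real M ^ Suc l)\<^sup>2 / (2 * real V)) * real V ^ (M * V)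
      \<le> real (card {F \<in> {1..V} \<times> {1..M} \<rightarrow>\<^sub>E {1..V}. inj_on F ?D})"
      unfolding card_D by (simp add: card_cartesian_product mult.commute)
    moreover have "0 < real V ^ (M * V)" using V by simp
    ultimately show ?thesis using False by (simp add: pos_le_divide_eq)
  qed
  have "0 \<le> ?Q" using P_nonneg \<kappa>N by (intro prod_nonneg) blast
  then have "(1 - (if k = 0 then 0 else (real M ^ Suc l)\<^sup>2 / (2 * real V))) * ?Q
      \<le> ?Q * (real (card {F \<in> {1..V} \<times> {1..M} \<rightarrow>\<^sub>E {1..V}. ?Z F}) / real V ^ (M * V))"
    unfolding mult.commute[of ?Q] using choices by (rule mult_right_mono[rotated])
  also have "\<dots> = (\<Sum>a\<in>?G. tree_ifs_prob M V P a)"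
    by (subst sum_tree_ifs_prob[where X="?X" and Z="?Z"]) (simp only: labels)
  finally show "(1 - (if k = 0 then 0 else (real M ^ Suc l)\<^sup>2 / (2 * real V))) * ?Q
      \<le> (\<Sum>a\<in>?G. tree_ifs_prob M V P a)" .
qed

text \<open>Keep only the good indices in the invariance equation. Each maps agreement below level l
  + 1 into agreement below level \<open>l\<close>, and the errors add up since (1 - \<delta>) (1 -
  \<epsilon>) >= 1 - (\<delta> + \<epsilon>).\<close>

lemma measure_matching_ge:
  assumes \<mu>: "invariant_measure \<mu>" and \<kappa>: "\<kappa> \<in> code_trees M N"
    and "e \<in> level M l \<rightarrow> {1..V}" "k = 0 \<or> inj_on e (level M l)"
  shows "(1 - collision_bound l k) * (\<Prod>w\<in>levels M l k. P (\<kappa> w)) \<le> measure \<mu> (matching l k e \<kappa>)"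
  using assms(3,4)
proof (induction k arbitrary: l e)
  case 0
  interpret prob_space \<mu> using \<mu> by (simp add: invariant_measure_def borel_prob_def)
  have "space \<mu> = tree_tuples M N V" using \<mu> borel_prob_space by (simp add: invariant_measure_def)
  then show ?case using prob_space by (simp add: collision_bound_def)
next
  case (Suc k)
  interpret prob_space \<mu> using \<mu> by (simp add: invariant_measure_def borel_prob_def)
  let ?I = "tree_ifs_index M N V" and ?p = "tree_ifs_prob M V P"
  let ?C = "matching l (Suc k) e \<kappa>"
  let ?pre = "\<lambda>a. {x \<in> tree_tuples M N V. tree_ifs_map M V a x \<in> ?C}"
  define Q where "Q = (\<Prod>w\<in>levels M (Suc l) k. P (\<kappa> w))"
  define Q0 where "Q0 = (\<Prod>j\<in>level M l. P (\<kappa> j))"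
  define \<epsilon> where "\<epsilon> = collision_bound (Suc l) k"
  define \<delta> where "\<delta> = (if k = 0 then 0 else (real M ^ Suc l)\<^sup>2 / (2 * real V))"
  have P\<kappa>: "0 \<le> P (\<kappa> w)" if "w \<in> words M" for w
    using \<kappa> that P_nonneg unfolding code_trees_def by blast
  have Q_nonneg: "0 \<le> Q" "0 \<le> Q0"
    unfolding Q_def Q0_def by (intro prod_nonneg; auto simp: levels_def level_def intro: P\<kappa>)+
  have nonneg: "0 \<le> \<delta>" "0 \<le> \<epsilon>" using collision_bound_nonneg by (simp_all add: \<delta>_def \<epsilon>_def)
  have split: "(\<Prod>w\<in>levels M l (Suc k). P (\<kappa> w)) = Q0 * Q"
    unfolding levels_Suc Q_def Q0_def
    by (intro prod.union_disjoint level_disjoint_levels) simp_all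
  have bound: "collision_bound l (Suc k) = \<delta> + \<epsilon>"
    unfolding \<delta>_def \<epsilon>_def by (rule collision_bound_Suc)
  have "(1 - (\<delta> + \<epsilon>)) * (Q0 * Q) \<le> measure \<mu> ?C"
  \<comment> \<open>If \<epsilon> > 1, the left side is at most 0. Otherwise 1 - \<epsilon> is
    nonnegative, so the bound on the weight of \<open>G\<close> may be multiplied by it.\<close>
  proof (cases "\<epsilon> \<le> 1")
    case False
    have "(1 - (\<delta> + \<epsilon>)) * (Q0 * Q) \<le> 0"
      using False nonneg Q_nonneg by (intro mult_nonpos_nonneg) auto
    then show ?thesis using measure_nonneg[of \<mu> ?C] by linarith
  next
    case True
    obtain G where G: "G \<subseteq> ?I" "\<And>a. a \<in> G \<Longrightarrow> \<forall>j\<in>level M l. fst (a (e j)) = \<kappa> j"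
      "\<And>a. a \<in> G \<Longrightarrow> k = 0 \<or> inj_on (child_buffer e a) (level M (Suc l))"
      and weight: "(1 - \<delta>) * Q0 \<le> (\<Sum>a\<in>G. ?p a)"
      using good_index_prob[OF Suc.prems(1) _ \<kappa>, of k] Suc.prems(2) unfolding \<delta>_def Q0_def by blast
    have C: "?C \<in> sets (borel_sigma (tree_tuples M N V) (tuple_dist M V))"
      using Suc.prems(1) by (rule matching_in_sets)
    have "(1 - (\<delta> + \<epsilon>)) * (Q0 * Q) \<le> ((1 - \<delta>) * Q0) * ((1 - \<epsilon>) * Q)"
    proof -
      have "((1 - \<delta>) * Q0) * ((1 - \<epsilon>) * Q) = (1 - (\<delta> + \<epsilon>)) * (Q0 * Q) + \<delta> * \<epsilon> * (Q0 * Q)"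
        by (simp add: algebra_simps)
      moreover have "0 \<le> \<delta> * \<epsilon> * (Q0 * Q)" using nonneg Q_nonneg by simp
      ultimately show ?thesis by linarith
    qed
    also have "\<dots> \<le> (\<Sum>a\<in>G. ?p a) * ((1 - \<epsilon>) * Q)"
      using weight True Q_nonneg by (intro mult_right_mono) auto
    also have "\<dots> = (\<Sum>a\<in>G. ?p a * ((1 - \<epsilon>) * Q))" by (rule sum_distrib_right)
    also have "\<dots> \<le> (\<Sum>a\<in>G. ?p a * measure \<mu> (?pre a))"
    proof (intro sum_mono mult_left_mono)
      fix a assume a: "a \<in> G"
      then have aI: "a \<in> ?I" using G(1) by blast
      show "0 \<le> ?p a" using aI by (rule p_nonneg)
      have child: "child_buffer e a \<in> level M (Suc l) \<rightarrow> {1..V}"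
        using aI Suc.prems(1) by (rule child_buffer_in)
      have "(1 - \<epsilon>) * Q \<le> measure \<mu> (matching (Suc l) k (child_buffer e a) \<kappa>)"
        unfolding \<epsilon>_def Q_def using child G(3)[OF a] by (rule Suc.IH)
      also have "\<dots> \<le> measure \<mu> (?pre a)"
      proof (rule finite_measure_mono)
        show "matching (Suc l) k (child_buffer e a) \<kappa> \<subseteq> ?pre a"
          using tree_ifs_map_matching[where k=k, OF aI Suc.prems(1) G(2)[OF a]] by (auto simp: matching_def)
        have "?pre a = tree_ifs_map M V a -` ?C \<inter> space (borel_sigma (tree_tuples M N V) (tuple_dist M V))"
          by auto
        also have "\<dots> \<in> sets (borel_sigma (tree_tuples M N V) (tuple_dist M V))"
          by (rule measurable_sets[OF measurable_g[OF aI] C])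
        finally show "?pre a \<in> sets \<mu>" using \<mu> by (simp add: invariant_measure_def borel_prob_def)
      qed
      finally show "(1 - \<epsilon>) * Q \<le> measure \<mu> (?pre a)" .
    qed
    also have "\<dots> \<le> (\<Sum>a\<in>?I. ?p a * measure \<mu> (?pre a))"
      using finite_I G(1) p_nonneg by (intro sum_mono2) auto
    also have "\<dots> = measure \<mu> ?C"
      using \<mu> C unfolding invariant_measure_def by (intro sym[of "measure \<mu> ?C"]) blast
    finally show ?thesis .
  qed
  then show ?case unfolding split bound .
qed

text \<open>The first tree has its root in buffer 1, and a constant assignment is injective on the
  single node of level 0. Projection to the first component thus turns masses of
  \<open>matching\<close> into masses of cylinders.\<close>

lemma V_variable_tree_law:
  shows "borel_prob (code_trees M N) (tree_dist M) (V_variable_tree_law M N V P)"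
    and "\<kappa> \<in> code_trees M N \<Longrightarrow>
      (1 - collision_bound 0 k) * (\<Prod>w\<in>levels M 0 k. P (\<kappa> w))
      \<le> measure (V_variable_tree_law M N V P) (T.cylinder k (tree_restr M k \<kappa>))"
proof -
  let ?\<mu> = "V_variable_tuple_law M N V P"
  let ?B = "borel_sigma (code_trees M N) (tree_dist M)"
  have inv: "invariant_measure ?\<mu>"
    unfolding V_variable_tuple_law_def by (rule invariant_measure_attractor)
  then have bp: "borel_prob (tree_tuples M N V) (tuple_dist M V) ?\<mu>" by (simp add: invariant_measure_def)
  then interpret prob_space ?\<mu> by (simp add: borel_prob_def)
  have sp: "space ?\<mu> = tree_tuples M N V" using bp by (rule borel_prob_space)
  have pre: "{x \<in> tree_tuples M N V. tree_restr M k (x 1) = tree_restr M k \<kappa>} = matching 0 k (\<lambda>_. 1) \<kappa>" for k \<kappa>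
    by (intro set_eqI) (simp only: matching_root_iff mem_Collect_eq)
  have meas: "(\<lambda>x. x 1) \<in> measurable ?\<mu> ?B"
  proof (rule T.measurable_borel_sigmaI)
    show "(\<lambda>x. x 1) \<in> space ?\<mu> \<rightarrow> code_trees M N" using first_tree_in sp by auto
    fix k c assume "c \<in> tree_restr M k ` code_trees M N"
    then obtain \<kappa> where "c = tree_restr M k \<kappa>" by blast
    then have "{x \<in> space ?\<mu>. tree_restr M k (x 1) = c} = matching 0 k (\<lambda>_. 1) \<kappa>"
      using pre[of k \<kappa>] by (simp add: sp)
    also have "\<dots> \<in> sets ?\<mu>"
      using matching_in_sets[of "\<lambda>_. 1" 0] V bp by (simp add: borel_prob_def)
    finally show "{x \<in> space ?\<mu>. tree_restr M k (x 1) = c} \<in> sets ?\<mu>" .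
  qed
  show "borel_prob (code_trees M N) (tree_dist M) (V_variable_tree_law M N V P)"
    unfolding V_variable_tree_law_def borel_prob_def using prob_space_distr[OF meas] by simp
  assume \<kappa>: "\<kappa> \<in> code_trees M N"
  have "measure (V_variable_tree_law M N V P) (T.cylinder k (tree_restr M k \<kappa>))
      = measure ?\<mu> ((\<lambda>x. x 1) -` T.cylinder k (tree_restr M k \<kappa>) \<inter> space ?\<mu>)"
    unfolding V_variable_tree_law_def by (rule measure_distr[OF meas T.cylinder_in_sets])
  also have "(\<lambda>x. x 1) -` T.cylinder k (tree_restr M k \<kappa>) \<inter> space ?\<mu> = matching 0 k (\<lambda>_. 1) \<kappa>"
    unfolding pre[symmetric] sp using first_tree_in by (auto simp: T.cylinder_def)
  finally show "(1 - collision_bound 0 k) * (\<Prod>w\<in>levels M 0 k. P (\<kappa> w))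
      \<le> measure (V_variable_tree_law M N V P) (T.cylinder k (tree_restr M k \<kappa>))"
    using measure_matching_ge[OF inv \<kappa>, of "\<lambda>_. 1" 0 k] V by simp
qed

end

subsection \<open>The law of the i.i.d. tree\<close>

definition iid_tree_measure :: "nat \<Rightarrow> nat \<Rightarrow> (nat \<Rightarrow> real) \<Rightarrow> (nat list \<Rightarrow> nat) measure \<Rightarrow> bool" where
  "iid_tree_measure M N P \<mu> \<longleftrightarrow> borel_prob (code_trees M N) (tree_dist M) \<mu> \<and>
     prob_space.indep_vars \<mu> (\<lambda>_. count_space {1..N}) (\<lambda>i \<tau>. \<tau> i) (words M) \<and>
     (\<forall>i\<in>words M. \<forall>n\<in>{1..N}. measure \<mu> {\<tau>\<in>code_trees M N. \<tau> i = n} = P n)"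

context V_variable_system
begin

lemma iid_tree_measure_cylinder:
  assumes \<mu>: "iid_tree_measure M N P \<mu>" and \<kappa>: "\<kappa> \<in> code_trees M N"
  shows "measure \<mu> (T.cylinder k (tree_restr M k \<kappa>)) = (\<Prod>w\<in>levels M 0 k. P (\<kappa> w))"
proof -
  have bp: "borel_prob (code_trees M N) (tree_dist M) \<mu>" using \<mu> by (simp add: iid_tree_measure_def)
  interpret prob_space \<mu> using bp by (simp add: borel_prob_def)
  have sp: "space \<mu> = code_trees M N" using bp by (rule T.borel_prob_space)
  have \<kappa>N: "\<kappa> i \<in> {1..N}" if "i \<in> words M" for i using \<kappa> that unfolding code_trees_def by blast
  have cyl: "T.cylinder k (tree_restr M k \<kappa>) = {\<tau> \<in> code_trees M N. \<forall>i\<in>levels M 0 k. \<tau> i = \<kappa> i}"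
    by (auto simp: T.cylinder_def tree_restr_eq_iff)
  show ?thesis
  \<comment> \<open>At depth 0 no coordinate is tested, whereas the product formula for independent
    variables asks for a non-empty index set.\<close>
  proof (cases "levels M 0 k = {}")
    case True
    then show ?thesis unfolding cyl True using prob_space by (simp add: sp)
  next
    case False
    have "T.cylinder k (tree_restr M k \<kappa>) = (\<Inter>i\<in>levels M 0 k. (\<lambda>\<tau>. \<tau> i) -` {\<kappa> i} \<inter> space \<mu>)"
      unfolding cyl sp using False by blast
    also have "prob \<dots> = (\<Prod>i\<in>levels M 0 k. prob ((\<lambda>\<tau>. \<tau> i) -` {\<kappa> i} \<inter> space \<mu>))"
    proof (rule indep_varsD)
      show "indep_vars (\<lambda>_. count_space {1..N}) (\<lambda>i \<tau>. \<tau> i) (words M)"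
        using \<mu> unfolding iid_tree_measure_def by blast
      show "{\<kappa> i} \<in> sets (count_space {1..N})" if "i \<in> levels M 0 k" for i
        using \<kappa>N[of i] that levels_subset_words[of M 0 k] by (simp del: atLeastAtMost_iff) blast
    qed (use False levels_subset_words in auto)
    also have "\<dots> = (\<Prod>i\<in>levels M 0 k. P (\<kappa> i))"
    proof (rule prod.cong[OF refl])
      fix i assume "i \<in> levels M 0 k"
      then have i: "i \<in> words M" using levels_subset_words by blast
      have "(\<lambda>\<tau>. \<tau> i) -` {\<kappa> i} \<inter> space \<mu> = {\<tau> \<in> code_trees M N. \<tau> i = \<kappa> i}" by (auto simp: sp)
      then show "prob ((\<lambda>\<tau>. \<tau> i) -` {\<kappa> i} \<inter> space \<mu>) = P (\<kappa> i)"
        using \<mu> i \<kappa>N[OF i] unfolding iid_tree_measure_def by simp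
    qed
    finally show ?thesis .
  qed
qed

lemma ex_iid_tree_measure: "\<exists>\<mu>. iid_tree_measure M N P \<mu>"
proof -
  define Q where "Q = point_measure {1..N} P"
  have space_Q: "space Q = {1..N}" and sets_Q: "sets Q = Pow {1..N}"
    by (simp_all add: Q_def space_point_measure sets_point_measure)
  have Q: "prob_space Q"
    unfolding Q_def
  proof (rule prob_space_point_measure)
    have "(\<Sum>n\<in>{1..N}. ennreal (P n)) = ennreal (\<Sum>n\<in>{1..N}. P n)"
      by (rule sum_ennreal) (rule P_nonneg)
    then show "(\<Sum>n\<in>{1..N}. ennreal (P n)) = 1" by (simp only: P_sum ennreal_1)
  qed simp_all
  let ?B = "borel_sigma (code_trees M N) (tree_dist M)"
  define \<mu> where "\<mu> = PiM (words M) (\<lambda>_. Q)"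
  interpret prob_space \<mu> unfolding \<mu>_def using Q by (intro prob_space_PiM)
  have space_\<mu>: "space \<mu> = code_trees M N" by (simp add: \<mu>_def space_PiM space_Q code_trees_def)
  have coord: "(\<lambda>\<tau>. \<tau> i) \<in> measurable \<mu> Q" if "i \<in> words M" for i
    unfolding \<mu>_def using that by (rule measurable_component_singleton)
  have coord_sets: "{\<tau> \<in> code_trees M N. \<tau> i = n} \<in> sets \<mu>" if "i \<in> words M" for i n
  proof (cases "n \<in> {1..N}")
    case True
    have "{\<tau> \<in> code_trees M N. \<tau> i = n} = (\<lambda>\<tau>. \<tau> i) -` {n} \<inter> space \<mu>" by (auto simp: space_\<mu>)
    then show ?thesis using True measurable_sets[OF coord[OF that], of "{n}"] by (simp add: sets_Q)
  next
    case False
    then have "{\<tau> \<in> code_trees M N. \<tau> i = n} = {}" using that unfolding code_trees_def by blast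
    then show ?thesis by (simp only: sets.empty_sets)
  qed
  \<comment> \<open>A cylinder constrains finitely many coordinates; conversely, coordinate
    \<open>i\<close> can be read off the restriction to depth \<open>Suc (length i)\<close>. Hence
    the product and the Borel sigma-algebra coincide.\<close>
  have sets_\<mu>: "sets \<mu> = sets ?B"
  proof
    have "(\<lambda>\<tau>. \<tau>) \<in> measurable \<mu> ?B"
    proof (rule T.measurable_borel_sigmaI)
      fix k c assume "c \<in> tree_restr M k ` code_trees M N"
      then obtain \<kappa> where "c = tree_restr M k \<kappa>" by blast
      then have "{\<tau> \<in> space \<mu>. tree_restr M k \<tau> = c}
          = {\<tau> \<in> space \<mu>. \<forall>i\<in>levels M 0 k. \<tau> i = \<kappa> i}"
        by (simp add: tree_restr_eq_iff)
      also have "\<dots> \<in> sets \<mu>"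
        using coord_sets levels_subset_words[of M 0 k]
        by (intro sets.sets_Collect_finite_All finite_levels) (auto simp: space_\<mu>)
      finally show "{\<tau> \<in> space \<mu>. tree_restr M k \<tau> = c} \<in> sets \<mu>" .
    qed (simp add: space_\<mu>)
    note measurable_id = this
    show "sets ?B \<subseteq> sets \<mu>"
    proof
      fix A assume A: "A \<in> sets ?B"
      then have "A \<subseteq> code_trees M N" using sets.sets_into_space by fastforce
      then show "A \<in> sets \<mu>"
        using measurable_sets[OF measurable_id A] by (simp add: space_\<mu> Int_absorb2)
    qed
    show "sets \<mu> \<subseteq> sets ?B"
      unfolding \<mu>_def
    proof (rule sets_PiM_in_sets)
      show "space ?B = (\<Pi>\<^sub>E i\<in>words M. space Q)"
        unfolding T.space_borel_sigma by (simp only: space_Q code_trees_def)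
      fix i A assume i: "i \<in> words M"
      have "{\<tau> \<in> space ?B. \<tau> i \<in> A} = {\<tau> \<in> code_trees M N. tree_restr M (Suc (length i)) \<tau> i \<in> A}"
        using i by (simp add: tree_restr_def mem_levels_iff)
      also have "\<dots> \<in> sets ?B" by (rule T.restr_Collect_in_sets)
      finally show "{\<tau> \<in> space ?B. \<tau> i \<in> A} \<in> sets ?B" .
    qed
  qed
  have bp: "borel_prob (code_trees M N) (tree_dist M) \<mu>"
    unfolding borel_prob_def using prob_space_axioms sets_\<mu> by blast
  have distr_coord: "distr \<mu> (count_space {1..N}) (\<lambda>\<tau>. \<tau> i) = Q" if "i \<in> words M" for i
  proof -
    have "distr \<mu> (count_space {1..N}) (\<lambda>\<tau>. \<tau> i) = distr \<mu> Q (\<lambda>\<tau>. \<tau> i)"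
      by (rule distr_cong) (simp_all add: sets_Q)
    then show ?thesis unfolding \<mu>_def using Q that distr_PiM_component[of "words M" "\<lambda>_. Q" i] by simp
  qed
  have "indep_vars (\<lambda>_. count_space {1..N}) (\<lambda>i \<tau>. \<tau> i) (words M)"
  \<comment> \<open>Independence means that the joint law is the product of the marginals; here the
    joint map is the identity.\<close>
  proof (subst indep_vars_iff_distr_eq_PiM')
    show "words M \<noteq> {}" using Nil_in_words by blast
    show "random_variable (count_space {1..N}) (\<lambda>\<tau>. \<tau> i)" if "i \<in> words M" for i
      using coord[OF that] measurable_cong_sets[OF refl, of Q "count_space {1..N}" \<mu>] by (simp add: sets_Q)
    have "distr \<mu> (PiM (words M) (\<lambda>_. count_space {1..N})) (\<lambda>\<tau>. \<lambda>i\<in>words M. \<tau> i)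
        = distr \<mu> \<mu> (\<lambda>\<tau>. \<tau>)"
    proof (rule distr_cong)
      show "sets (PiM (words M) (\<lambda>_. count_space {1..N})) = sets \<mu>"
        unfolding \<mu>_def by (intro sets_PiM_cong) (simp_all add: sets_Q)
      show "restrict \<tau> (words M) = \<tau>" if "\<tau> \<in> space \<mu>" for \<tau>
        using that unfolding space_\<mu> code_trees_def by (rule PiE_restrict)
    qed simp
    also have "\<dots> = PiM (words M) (\<lambda>i. distr \<mu> (count_space {1..N}) (\<lambda>\<tau>. \<tau> i))"
      using distr_coord by (simp add: \<mu>_def cong: PiM_cong)
    finally show "distr \<mu> (PiM (words M) (\<lambda>_. count_space {1..N})) (\<lambda>\<tau>. \<lambda>i\<in>words M. \<tau> i)
        = PiM (words M) (\<lambda>i. distr \<mu> (count_space {1..N}) (\<lambda>\<tau>. \<tau> i))" .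
  qed
  moreover have "measure \<mu> {\<tau>\<in>code_trees M N. \<tau> i = n} = P n" if i: "i \<in> words M" and n: "n \<in> {1..N}" for i n
  proof -
    have "{\<tau>\<in>code_trees M N. \<tau> i = n} = (\<lambda>\<tau>. \<tau> i) -` {n} \<inter> space \<mu>" by (auto simp: space_\<mu>)
    also have "measure \<mu> \<dots> = measure (distr \<mu> Q (\<lambda>\<tau>. \<tau> i)) {n}"
      using n by (intro measure_distr[symmetric] coord i) (simp add: sets_Q)
    also have "distr \<mu> Q (\<lambda>\<tau>. \<tau> i) = Q"
      unfolding \<mu>_def using Q i by (intro distr_PiM_component)
    also have "measure Q {n} = P n"
      unfolding Q_def using n P_nonneg by (subst measure_point_measure_finite_if) auto
    finally show ?thesis .
  qed
  ultimately show ?thesis using bp unfolding iid_tree_measure_def by blast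
qed

lemma iid_tree_law: "iid_tree_measure M N P (iid_tree_law M N P)"
proof -
  have "\<mu> = \<nu>" if \<mu>: "iid_tree_measure M N P \<mu>" and \<nu>: "iid_tree_measure M N P \<nu>" for \<mu> \<nu>
  proof (rule T.borel_prob_eqI)
    show "borel_prob (code_trees M N) (tree_dist M) \<mu>" "borel_prob (code_trees M N) (tree_dist M) \<nu>"
      using \<mu> \<nu> by (simp_all add: iid_tree_measure_def)
    fix k c assume "c \<in> tree_restr M k ` code_trees M N"
    then show "measure \<mu> (T.cylinder k c) = measure \<nu> (T.cylinder k c)"
      using iid_tree_measure_cylinder \<mu> \<nu> by auto
  qed
  then have "\<exists>!\<mu>. iid_tree_measure M N P \<mu>" using ex_iid_tree_measure by blast
  from theI'[OF this] show ?thesis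
    unfolding iid_tree_law_def iid_tree_measure_def .
qed

subsection \<open>The rate of convergence\<close>

text \<open>A geometric sum with ratio M^2 >= 4 is at most 4/3 times its last term, and the factor
  1/2 of the union bound leaves 2/3.\<close>

lemma collision_bound_le: "collision_bound 0 (Suc k) \<le> 2 / 3 * (real M ^ k)\<^sup>2 / real V"
proof -
  have M4: "4 * a \<le> (real M)\<^sup>2 * a" if "a \<ge> 0" for a
    using power_mono[of 2 "real M" 2] M that by (intro mult_right_mono) auto
  have "(\<Sum>t\<in>{0<..<Suc k}. (real M ^ t)\<^sup>2) \<le> 4 / 3 * (real M ^ k)\<^sup>2"
  proof (induction k)
    case 0
    have "{0<..<Suc 0} = {}" by auto
    then show ?case by simp
  next
    case (Suc k)
    have "{0<..<Suc (Suc k)} = insert (Suc k) {0<..<Suc k}" by auto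
    then have "(\<Sum>t\<in>{0<..<Suc (Suc k)}. (real M ^ t)\<^sup>2) \<le> (real M ^ Suc k)\<^sup>2 + 4 / 3 * (real M ^ k)\<^sup>2"
      using Suc by simp
    moreover have "4 * (real M ^ k)\<^sup>2 \<le> (real M ^ Suc k)\<^sup>2"
      using M4[of "(real M ^ k)\<^sup>2"] by (simp add: power_mult_distrib)
    ultimately show ?case by linarith
  qed
  then show ?thesis
    unfolding collision_bound_def using V by (simp add: divide_simps flip: sum_divide_distrib)
qed

lemma monge_kantorovich_V_variable_tree_law:
  "monge_kantorovich (code_trees M N) (tree_dist M) (V_variable_tree_law M N V P) (iid_tree_law M N P)
     \<le> 1.4 * (real M / real V) powr (1 / 4)"
  "0 \<le> monge_kantorovich (code_trees M N) (tree_dist M) (V_variable_tree_law M N V P) (iid_tree_law M N P)"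
proof -
  have bp: "borel_prob (code_trees M N) (tree_dist M) (iid_tree_law M N P)"
    using iid_tree_law by (simp add: iid_tree_measure_def)
  have mass: "(1 - collision_bound 0 k) * measure (iid_tree_law M N P) (T.cylinder k c)
      \<le> measure (V_variable_tree_law M N V P) (T.cylinder k c)"
    if "c \<in> tree_restr M k ` code_trees M N" for k c
    using that V_variable_tree_law(2) iid_tree_measure_cylinder[OF iid_tree_law] by auto
  note bounds = T.monge_kantorovich_bounds[OF V_variable_tree_law(1) bp mass collision_bound_nonneg]
  show "0 \<le> monge_kantorovich (code_trees M N) (tree_dist M) (V_variable_tree_law M N V P) (iid_tree_law M N P)"
    by (rule bounds(2))
  have "2 \<le> M ^ 4" using power_increasing[of 1 4 M] M by simp
  then obtain k where k: "(M ^ 4) ^ k \<le> V" "V < (M ^ 4) ^ (k + 1)" using ex_power_ivl1 V by blast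
  define y where "y = real V powr (1 / 4)"
  have y4: "y ^ 4 = real V" unfolding y_def using V by (simp flip: powr_realpow add: powr_powr)
  have y_pos: "y > 0" unfolding y_def using V by simp
  have "(real M ^ k) ^ 4 \<le> y ^ 4"
  proof -
    have "(real M ^ k) ^ 4 = real ((M ^ 4) ^ k)" by (simp flip: power_mult add: mult.commute)
    also have "\<dots> \<le> y ^ 4" unfolding y4 using k(1) by (simp only: of_nat_le_iff)
    finally show ?thesis .
  qed
  then have le_y: "real M ^ k \<le> y" using y_pos power_mono_iff[of "real M ^ k" y 4] by simp
  have "y ^ 4 \<le> (real M ^ Suc k) ^ 4"
  proof -
    have "y ^ 4 \<le> real ((M ^ 4) ^ Suc k)" unfolding y4 using k(2) by (simp only: of_nat_le_iff Suc_eq_plus1)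
    also have "\<dots> = (real M ^ Suc k) ^ 4"
      by (simp only: of_nat_power power_mult[symmetric] mult.commute)
    finally show ?thesis .
  qed
  then have y_le: "y \<le> real M ^ Suc k"
    using y_pos power_mono_iff[of y "real M ^ Suc k" 4] by simp
  \<comment> \<open>For k = 0 only the root is compared and nothing can collide. For k >= 1, y >= M
    >= 2 turns 2 / (3 y^2) into 1 / (3 y).\<close>
  have coll: "collision_bound 0 (Suc k) \<le> 1 / 3 / y"
  proof (cases "k = 0")
    case True
    have "{0<..<Suc 0} = {}" by auto
    then show ?thesis using True y_pos by (simp add: collision_bound_def)
  next
    case False
    have "real M \<le> real M ^ k" using False M by (intro self_le_power) auto
    then have "2 \<le> y" using le_y M by linarith
    have "collision_bound 0 (Suc k) \<le> 2 / 3 * (real M ^ k)\<^sup>2 / real V" by (rule collision_bound_le)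
    also have "\<dots> \<le> 2 / 3 * y\<^sup>2 / real V"
      using le_y by (intro divide_right_mono mult_left_mono power_mono) auto
    also have "\<dots> = 2 / 3 / (y * y)"
      unfolding y4[symmetric] using y_pos by (simp add: power2_eq_square power4_eq_xxxx)
    also have "\<dots> \<le> 2 / 3 / (2 * y)"
      using \<open>2 \<le> y\<close> y_pos by (intro divide_left_mono mult_right_mono) auto
    finally show ?thesis by simp
  qed
  have "1 / real M ^ Suc k \<le> 1 / y" using y_le y_pos by (intro divide_left_mono) auto
  then have "monge_kantorovich (code_trees M N) (tree_dist M) (V_variable_tree_law M N V P) (iid_tree_law M N P)
      \<le> 1 / y + 1 / 3 / y"
    using bounds(1)[of "Suc k"] coll by linarith
  \<comment> \<open>Here 4/3 is rounded up to 1.4; the factor M^(1/4) >= 1 is then inserted to reach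
    the stated form.\<close>
  also have "\<dots> \<le> 1.4 * (1 / y)" using y_pos by (simp add: field_simps)
  also have "\<dots> \<le> 1.4 * (real M powr (1 / 4) / y)"
    using M y_pos by (intro mult_left_mono divide_right_mono ge_one_powr_ge_zero) auto
  also have "\<dots> = 1.4 * (real M / real V) powr (1 / 4)"
    unfolding y_def by (simp add: powr_divide)
  finally show "monge_kantorovich (code_trees M N) (tree_dist M) (V_variable_tree_law M N V P) (iid_tree_law M N P)
      \<le> 1.4 * (real M / real V) powr (1 / 4)" .
qed

end

theorem theorem12:
  fixes M N :: nat and P :: "nat \<Rightarrow> real"
  assumes "M \<ge> 2" and "N \<ge> 1"
    and "\<And>n. n \<in> {1..N} \<Longrightarrow> P n > 0" and "(\<Sum>n\<in>{1..N}. P n) = 1"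
  shows "(\<forall>V\<ge>1. hausdorff_dist (tree_dist M) (V_variable_trees M N V) (code_trees M N)
                   < 1 / real V) \<and>
         (\<lambda>V. hausdorff_dist (tree_dist M) (V_variable_trees M N V) (code_trees M N))
           \<longlonglongrightarrow> 0 \<and>
         (\<forall>V\<ge>1. monge_kantorovich (code_trees M N) (tree_dist M)
                    (V_variable_tree_law M N V P) (iid_tree_law M N P)
                   \<le> 1.4 * (real M / real V) powr (1 / 4)) \<and>
         (\<lambda>V. monge_kantorovich (code_trees M N) (tree_dist M)
                (V_variable_tree_law M N V P) (iid_tree_law M N P)) \<longlonglongrightarrow> 0"
proof -
  have sys: "V_variable_system M N V P" if "V \<ge> 1" for V
    by unfold_locales (use assms that less_imp_le in auto)
  let ?h = "\<lambda>V. hausdorff_dist (tree_dist M) (V_variable_trees M N V) (code_trees M N)"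
  let ?m = "\<lambda>V. monge_kantorovich (code_trees M N) (tree_dist M)
    (V_variable_tree_law M N V P) (iid_tree_law M N P)"
  note h = V_variable_system.hausdorff_dist_V_variable_trees[OF sys]
  note m = V_variable_system.monge_kantorovich_V_variable_tree_law[OF sys]
  \<comment> \<open>The estimates are available for V >= 1, so both sandwich arguments use eventual
    bounds.\<close>
  have h0: "?h \<longlonglongrightarrow> 0"
  proof (rule tendsto_sandwich[OF _ _ tendsto_const lim_1_over_n])
    show "\<forall>\<^sub>F V in sequentially. 0 \<le> ?h V"
      using eventually_ge_at_top[of 1] by eventually_elim (rule h(2))
    show "\<forall>\<^sub>F V in sequentially. ?h V \<le> 1 / of_nat V"
      using eventually_ge_at_top[of 1] by eventually_elim (rule less_imp_le[OF h(1)])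
  qed
  have lim: "(\<lambda>V. 1.4 * (real M / real V) powr (1 / 4)) \<longlonglongrightarrow> 0"
    using assms(1) by real_asymp
  have m0: "?m \<longlonglongrightarrow> 0"
  proof (rule tendsto_sandwich[OF _ _ tendsto_const lim])
    show "\<forall>\<^sub>F V in sequentially. 0 \<le> ?m V"
      using eventually_ge_at_top[of 1] by eventually_elim (rule m(2))
    show "\<forall>\<^sub>F V in sequentially. ?m V \<le> 1.4 * (real M / real V) powr (1 / 4)"
      using eventually_ge_at_top[of 1] by eventually_elim (rule m(1))
  qed
  show ?thesis
    using h(1) m(1) h0 m0 by blast
qed

end
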